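(* Let $n\ge 1$ and let $M$ be any closed $n$-manifold. Then the suspension $\sum M$ does not embed in a product of $n+1$ curves; that is, there do not exist curves $Y_1,\dots,Y_{n+1}$ and a topological embedding $\sum M\to Y_1\times\cdots\times Y_{n+1}$.
   Context: All spaces are metrizable and all maps are continuous. A compactum is a compact metric space; a continuum is a connected compactum; a curve is a $1$-dimensional continuum. A closed $n$-manifold is a compact $n$-dimensional space in which every point has an open neighborhood that is an open $n$-disc (homeomorphic to $\mathbb{R}^n$). It need not be connected. The suspension $\sum M$ is the unreduced suspension: the quotient of $M\times[-1,1]$ obtained by collapsing $M\times\{1\}$ to one point and $M\times\{-1\}$ to another point. *)

theory Defs
  imports "HOL-Analysis.Analysis"
begin

(* dim_le is the library's small inductive dimension, with the empty space in dimension -1.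
   On separable metrizable spaces, hence on all compacta, it agrees with the covering dimension
   and with the large inductive dimension. *)
definition has_dimension :: "'a topology \<Rightarrow> nat \<Rightarrow> bool" where
  "has_dimension X n \<longleftrightarrow> X dim_le int n \<and> \<not> X dim_le (int n - 1)"

definition compactum :: "'a topology \<Rightarrow> bool" where
  "compactum X \<longleftrightarrow> metrizable_space X \<and> compact_space X"

definition continuum :: "'a topology \<Rightarrow> bool" where
  "continuum X \<longleftrightarrow> compactum X \<and> connected_space X"

definition curve :: "'a topology \<Rightarrow> bool" where
  "curve X \<longleftrightarrow> continuum X \<and> has_dimension X 1"

(* Having dimension n excludes the empty space. *)
definition closed_manifold :: "nat \<Rightarrow> 'a topology \<Rightarrow> bool" where
  "closed_manifold n M \<longleftrightarrow>
     compactum M \<and> has_dimension M n \<and>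
     (\<forall>x\<in>topspace M. \<exists>U. openin M U \<and> x \<in> U \<and>
        subtopology M U homeomorphic_space Euclidean_space n)"

definition quotient_topology :: "'a topology \<Rightarrow> ('a \<Rightarrow> 'b) \<Rightarrow> 'b topology" where
  "quotient_topology X q =
     topology (\<lambda>U. U \<subseteq> q ` topspace X \<and> openin X {x \<in> topspace X. q x \<in> U})"

lemma istopology_quotient:
  "istopology (\<lambda>U. U \<subseteq> q ` topspace X \<and> openin X {x \<in> topspace X. q x \<in> U})"
proof -
  have "openin X {x \<in> topspace X. q x \<in> S \<inter> T}"
    if "openin X {x \<in> topspace X. q x \<in> S}" "openin X {x \<in> topspace X. q x \<in> T}" for S T
  proof -
    have "{x \<in> topspace X. q x \<in> S \<inter> T}
        = {x \<in> topspace X. q x \<in> S} \<inter> {x \<in> topspace X. q x \<in> T}" by auto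
    then show ?thesis using that by (simp add: openin_Int)
  qed
  moreover have "openin X {x \<in> topspace X. q x \<in> \<Union>K}"
    if "\<forall>S\<in>K. openin X {x \<in> topspace X. q x \<in> S}" for K
  proof -
    have "{x \<in> topspace X. q x \<in> \<Union>K} = (\<Union>S\<in>K. {x \<in> topspace X. q x \<in> S})" by auto
    then show ?thesis using that by auto
  qed
  ultimately show ?thesis unfolding istopology_def by blast
qed

lemma openin_quotient_topology:
  "openin (quotient_topology X q) U \<longleftrightarrow>
     U \<subseteq> q ` topspace X \<and> openin X {x \<in> topspace X. q x \<in> U}"
  unfolding quotient_topology_def topology_inverse'[OF istopology_quotient] ..

lemma topspace_quotient_topology: "topspace (quotient_topology X q) = q ` topspace X"
proof -
  have "{x \<in> topspace X. q x \<in> q ` topspace X} = topspace X" by auto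
  then have "openin (quotient_topology X q) (q ` topspace X)"
    by (simp add: openin_quotient_topology)
  moreover have "topspace (quotient_topology X q) \<subseteq> q ` topspace X"
    using openin_topspace[of "quotient_topology X q"] unfolding openin_quotient_topology by blast
  ultimately show ?thesis by (simp add: openin_subset subset_antisym)
qed

lemma quotient_map_quotient_topology: "quotient_map X (quotient_topology X q) q"
  by (simp add: quotient_map_def openin_quotient_topology topspace_quotient_topology)

definition cylinder :: "'a topology \<Rightarrow> ('a \<times> real) topology" where
  "cylinder M = prod_topology M (top_of_set {-1..1})"

definition suspension_rel :: "'a topology \<Rightarrow> (('a \<times> real) \<times> ('a \<times> real)) set" where
  "suspension_rel M =
     {(p, p') \<in> topspace (cylinder M) \<times> topspace (cylinder M).
        p = p' \<or> snd p = 1 \<and> snd p' = 1 \<or> snd p = -1 \<and> snd p' = -1}"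

lemma equiv_suspension_rel: "equiv (topspace (cylinder M)) (suspension_rel M)"
proof (rule equivI)
  show "suspension_rel M \<subseteq> topspace (cylinder M) \<times> topspace (cylinder M)"
    by (auto simp: suspension_rel_def)
  show "refl_on (topspace (cylinder M)) (suspension_rel M)"
    by (simp add: suspension_rel_def refl_on_def)
  show "sym (suspension_rel M)"
    unfolding suspension_rel_def by (rule symI) blast
  show "trans (suspension_rel M)"
    unfolding suspension_rel_def by (rule transI, clarsimp) (elim disjE; simp)
qed

(* The points of the suspension are the equivalence classes. *)
definition suspension :: "'a topology \<Rightarrow> ('a \<times> real) set topology" where
  "suspension M = quotient_topology (cylinder M) (\<lambda>p. suspension_rel M `` {p})"

lemma topspace_suspension:
  "topspace (suspension M) = topspace (cylinder M) // suspension_rel M"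
  by (auto simp: suspension_def topspace_quotient_topology quotient_def)

end

(* Suppose the suspension of M embeds in a product of m = n + 1 curves; restrict it to one component
   of M and call the image X.  Then X is a unicoherent Peano continuum, because circle-valued maps on
   it lift to the line along the suspension coordinate.  Hence two points of X with different i-th
   coordinates are separated by a connected set that lies over a single point of the i-th curve.
   Such separators give a height function h i on X whose merge tree (the tree of components of the
   superlevel sets) still tells apart points with different i-th coordinates, so X embeds in a
   product of m rooted trees.

   Trees can be cut into small pieces that are coloured with m + 1 colours, so that the Lebesgue
   covering theorem (Kuhn's lemma) applies to maps of the (m+1)-cube into a product of m trees.
   Consequently an m-cell in such a product has no peak: above its centre, in all tree orders, there
   is another point of the cell.  If the root is the image of one pole, maximising the total height
   then shows that every point of X lies below the other pole.  So all the trees are arcs and X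
   embeds in m-space by h.  A linear functional that agrees on the two poles attains its maximum or
   its minimum at some other point, and after a linear change of coordinates that point is a peak. *)
theory Submission
  imports Defs
begin

section \<open>Kuhn's lemma on the unit cube and tree structures\<close>

text \<open>The obstacle is the poles: X has charts only away from them, and no information about
  the topology of M is available there. So every extremal argument must find its extremum at another
  point. Rooting all trees at one pole makes that pole lowest; maximising only above a point that is
  not below the other pole excludes the second one; a functional with equal values at the poles
  leaves an extremum elsewhere or is constant. The curves cannot serve as trees themselves, since
  they may contain circles and need not be locally connected. They enter only through the fact that
  a connected set inside a zero-dimensional frontier is a single point; all connectedness arguments
  take place in X. No homology is used. A cell is just a continuous injection of a cube, and the
  dimension count rests on matching the m + 1 colours with the m + 1 pairs of opposite faces of the
  (m+1)-cube, colour j being responsible for coordinate j.\<close>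

lemma continuous_map_realI:
  fixes f :: "'a \<Rightarrow> real"
  assumes "\<And>x \<epsilon>. x \<in> topspace X \<Longrightarrow> \<epsilon> > 0 \<Longrightarrow>
      \<exists>U. openin X U \<and> x \<in> U \<and> (\<forall>y\<in>U. dist (f y) (f x) < \<epsilon>)"
  shows "continuous_map X euclideanreal f"
  unfolding continuous_map_eq_topcontinuous_at topcontinuous_at_def
proof (intro ballI conjI allI impI)
  fix x V assume x: "x \<in> topspace X" and "openin euclideanreal V \<and> f x \<in> V"
  then obtain \<epsilon> where "\<epsilon> > 0" and \<epsilon>: "\<forall>z. dist z (f x) < \<epsilon> \<longrightarrow> z \<in> V"
    unfolding open_openin[symmetric] open_dist by blast
  with assms[OF x \<open>\<epsilon> > 0\<close>] show "\<exists>U. openin X U \<and> x \<in> U \<and> (\<forall>y\<in>U. f y \<in> V)" by blast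
qed auto

(* Points of N-space are functions on nat that vanish from N on. *)
definition unit_cube :: "nat \<Rightarrow> (nat \<Rightarrow> real) set" where
  "unit_cube N = {y. (\<forall>i<N. 0 \<le> y i \<and> y i \<le> 1) \<and> (\<forall>i\<ge>N. y i = 0)}"

lemma compact_unit_cube: "compact (unit_cube N)"
proof -
  have "y \<in> unit_cube N \<longleftrightarrow> (\<forall>i. y i \<in> (if i < N then {0..1} else {0}))" for y
    by (auto simp: unit_cube_def not_less)
  then have "unit_cube N = PiE UNIV (\<lambda>i. if i < N then {0..1} else {0})"
    by (simp only: PiE_UNIV_domain Pi_def set_eq_iff mem_Collect_eq UNIV_I simp_thms)
  moreover have "compactin (powertop_real UNIV) (PiE UNIV (\<lambda>i. if i < N then {0..1::real} else {0}))"
    by (subst compactin_PiE) auto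
  ultimately show ?thesis
    by (simp add: euclidean_product_topology)
qed

text \<open>The metric on functions weights coordinates by the powers \<open>(1/2) ^ n\<close>,
  which sum to 2. This turns the coordinatewise closeness that a grid provides into closeness in the
  metric.\<close>

lemma dist_fun_le_coordinates:
  fixes y z :: "nat \<Rightarrow> real"
  assumes "\<And>i. \<bar>y i - z i\<bar> \<le> c"
  shows "dist y z \<le> 2 * c"
proof -
  have c: "0 \<le> c" using assms[of 0] by linarith
  have s: "summable (\<lambda>n. (1/2::real)^n * c)"
    by (intro summable_mult2) (simp add: summable_geometric_iff)
  have "dist y z \<le> (\<Sum>n. (1/2::real)^n * c)"
    unfolding dist_fun_def
  proof (rule suminf_le)
    show "(1/2) ^ n * min (dist (y (from_nat n)) (z (from_nat n))) 1 \<le> (1/2) ^ n * c" for n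
      using assms[of "from_nat n"] by (intro mult_left_mono) (auto simp: dist_real_def)
    show "summable (\<lambda>n. (1/2) ^ n * min (dist (y (from_nat n)) (z (from_nat n))) 1)"
      by (rule summable_comparison_test'[of "\<lambda>n. (1/2)^n"]) (auto simp: summable_geometric_iff)
  qed (rule s)
  also have "\<dots> = 2 * c"
    using suminf_mult2[of "\<lambda>n. (1/2::real)^n" c] suminf_geometric[of "1/2::real"]
    by (simp add: summable_geometric_iff)
  finally show ?thesis .
qed

text \<open>The combinatorial \<open>kuhn_lemma\<close> is applied on a grid of mesh
  \<open>1 / real p\<close> below \<open>\<theta>\<close>. The predicates \<open>L j\<close> are
  arbitrary away from the faces, so a common place of change can be found only up to
  \<open>\<theta>\<close>; compactness removes this error later, in
  \<open>tree_lebesgue\<close>.\<close>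

lemma kuhn_unit_cube:
  assumes lo: "\<And>j y. j < N \<Longrightarrow> y \<in> unit_cube N \<Longrightarrow> y j = 0 \<Longrightarrow> L j y"
    and hi: "\<And>j y. j < N \<Longrightarrow> y \<in> unit_cube N \<Longrightarrow> y j = 1 \<Longrightarrow> \<not> L j y"
    and "\<theta> > 0"
  obtains y where "y \<in> unit_cube N"
    "\<And>j. j < N \<Longrightarrow> \<exists>r\<in>unit_cube N. \<exists>s\<in>unit_cube N.
        (\<forall>i. \<bar>r i - y i\<bar> < \<theta>) \<and> (\<forall>i. \<bar>s i - y i\<bar> < \<theta>) \<and> L j r \<and> \<not> L j s"
proof -
  obtain p :: nat where p: "0 < p" "1 / real p < \<theta>"
    using real_arch_inverse[of \<theta>] \<open>\<theta> > 0\<close> by (auto simp: inverse_eq_divide)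
  define g :: "(nat \<Rightarrow> nat) \<Rightarrow> nat \<Rightarrow> real" where
    "g = (\<lambda>q i. if i < N then real (q i) / real p else 0)"
  have g_cube: "g q \<in> unit_cube N" if "\<forall>i<N. q i \<le> p" for q
    using that p by (auto simp: g_def unit_cube_def)
  define label :: "(nat \<Rightarrow> nat) \<Rightarrow> nat \<Rightarrow> nat" where
    "label = (\<lambda>q j. if L j (g q) then 0 else 1)"
  obtain q where q: "\<forall>i<N. q i < p"
    and rs: "\<forall>i<N. \<exists>r s. (\<forall>j<N. q j \<le> r j \<and> r j \<le> q j + 1) \<and>
          (\<forall>j<N. q j \<le> s j \<and> s j \<le> q j + 1) \<and> label r i \<noteq> label s i"
  proof (rule kuhn_lemma[of p N label])
    show "\<forall>x. (\<forall>i<N. x i \<le> p) \<longrightarrow> (\<forall>i<N. x i = 0 \<longrightarrow> label x i = 0)"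
      using lo g_cube by (auto simp: label_def g_def)
    show "\<forall>x. (\<forall>i<N. x i \<le> p) \<longrightarrow> (\<forall>i<N. x i = p \<longrightarrow> label x i = 1)"
    proof (intro allI impI)
      fix x i assume "\<forall>i<N. x i \<le> p" "i < N" "x i = p"
      then have "\<not> L i (g x)"
        using hi[of i "g x"] g_cube[of x] p(1) by (simp add: g_def)
      then show "label x i = 1" by (simp add: label_def)
    qed
  qed (use p in \<open>auto simp: label_def\<close>)
  have near: "\<forall>i. \<bar>g r i - g q i\<bar> < \<theta>" and mem: "g r \<in> unit_cube N"
    if "\<forall>j<N. q j \<le> r j \<and> r j \<le> q j + 1" for r
  proof -
    show "\<forall>i. \<bar>g r i - g q i\<bar> < \<theta>"
    proof
      fix i
      show "\<bar>g r i - g q i\<bar> < \<theta>"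
      proof (cases "i < N")
        case True
        then have "\<bar>real (r i) - real (q i)\<bar> \<le> 1" 
            using that[rule_format, of i] by linarith
        then have "\<bar>real (r i) - real (q i)\<bar> / real p \<le> 1 / real p"
          by (intro divide_right_mono) auto
        then have "\<bar>g r i - g q i\<bar> \<le> 1 / real p"
          using True by (simp add: g_def diff_divide_distrib[symmetric])
        then show ?thesis using p by linarith
      qed (use \<open>\<theta> > 0\<close> in \<open>simp add: g_def\<close>)
    qed
    show "g r \<in> unit_cube N"
      using that q by (intro g_cube) (metis Suc_eq_plus1 Suc_leI le_trans)
  qed
  show thesis
  proof (rule that[of "g q"])
    show "g q \<in> unit_cube N" using q by (intro g_cube) (simp add: less_imp_le)
    fix j assume "j < N"
    then obtain r s where *: "\<forall>j<N. q j \<le> r j \<and> r j \<le> q j + 1"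
      "\<forall>j<N. q j \<le> s j \<and> s j \<le> q j + 1" "label r j \<noteq> label s j"
      using rs by blast
    then consider "L j (g r)" "\<not> L j (g s)" | "L j (g s)" "\<not> L j (g r)"
      by (auto simp: label_def split: if_splits)
    then show "\<exists>r\<in>unit_cube N. \<exists>s\<in>unit_cube N.
        (\<forall>i. \<bar>r i - g q i\<bar> < \<theta>) \<and> (\<forall>i. \<bar>s i - g q i\<bar> < \<theta>) \<and> L j r \<and> \<not> L j s"
      using near mem * by cases blast+
  qed
qed

(* A map into a rooted tree: s is the height of the image of a point, and \<mu> y z is the height at
   which the branches of the images of y and z part, so their distance is s y + s z - 2 \<mu> y z. *)
definition tree_structure :: "'a topology \<Rightarrow> ('a \<Rightarrow> real) \<Rightarrow> ('a \<Rightarrow> 'a \<Rightarrow> real) \<Rightarrow> bool" where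
  "tree_structure X s \<mu> \<longleftrightarrow>
     continuous_map X euclideanreal s \<and>
     (\<forall>y\<in>topspace X. \<forall>z\<in>topspace X. \<mu> y z = \<mu> z y \<and> \<mu> y z \<le> s y) \<and>
     (\<forall>y\<in>topspace X. \<forall>z\<in>topspace X. \<forall>w\<in>topspace X. min (\<mu> y z) (\<mu> z w) \<le> \<mu> y w) \<and>
     (\<forall>y\<in>topspace X. \<forall>\<epsilon>>0. \<exists>U. openin X U \<and> y \<in> U \<and> (\<forall>z\<in>U. \<forall>w\<in>U. s y - \<epsilon> < \<mu> z w))"

section \<open>Elementary properties and uniform continuity of tree structures\<close>

lemma tree_cont: "tree_structure X s \<mu> \<Longrightarrow> continuous_map X euclideanreal s"
  by (simp add: tree_structure_def)

lemma tree_sym: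
  "tree_structure X s \<mu> \<Longrightarrow> y \<in> topspace X \<Longrightarrow> z \<in> topspace X \<Longrightarrow> \<mu> y z = \<mu> z y"
  by (simp add: tree_structure_def)

lemma tree_le1:
  "tree_structure X s \<mu> \<Longrightarrow> y \<in> topspace X \<Longrightarrow> z \<in> topspace X \<Longrightarrow> \<mu> y z \<le> s y"
  by (simp add: tree_structure_def)

lemma tree_le2:
  "tree_structure X s \<mu> \<Longrightarrow> y \<in> topspace X \<Longrightarrow> z \<in> topspace X \<Longrightarrow> \<mu> y z \<le> s z"
  using tree_le1[of X s \<mu> z y] tree_sym[of X s \<mu> y z] by simp

lemma tree_ultra:
  "tree_structure X s \<mu> \<Longrightarrow> y \<in> topspace X \<Longrightarrow> z \<in> topspace X \<Longrightarrow> w \<in> topspace X \<Longrightarrow>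
    min (\<mu> y z) (\<mu> z w) \<le> \<mu> y w"
  unfolding tree_structure_def by blast

lemma tree_near:
  "tree_structure X s \<mu> \<Longrightarrow> y \<in> topspace X \<Longrightarrow> \<epsilon> > 0 \<Longrightarrow>
    \<exists>U. openin X U \<and> y \<in> U \<and> (\<forall>z\<in>U. \<forall>w\<in>U. s y - \<epsilon> < \<mu> z w)"
  unfolding tree_structure_def by blast

lemma tree_near_abs:
  assumes T: "tree_structure X s \<mu>" and y: "y \<in> topspace X" and "\<epsilon> > 0"
  obtains U where "openin X U" "y \<in> U" "\<And>z w. z \<in> U \<Longrightarrow> w \<in> U \<Longrightarrow> s y - \<epsilon> < \<mu> z w"
    "\<And>z. z \<in> U \<Longrightarrow> \<bar>s z - s y\<bar> < \<epsilon>"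
proof -
  obtain U where U: "openin X U" "y \<in> U" "\<forall>z\<in>U. \<forall>w\<in>U. s y - \<epsilon> < \<mu> z w"
    using tree_near[OF T y \<open>\<epsilon> > 0\<close>] by blast
  define V where "V = {z \<in> topspace X. s z \<in> ball (s y) \<epsilon>}"
  have "openin X V" unfolding V_def
    using openin_continuous_map_preimage[OF tree_cont[OF T], of "ball (s y) \<epsilon>"] by auto
  show thesis
  proof (rule that[of "U \<inter> V"])
    show "openin X (U \<inter> V)" using U \<open>openin X V\<close> by blast
    show "y \<in> U \<inter> V" using U y \<open>\<epsilon> > 0\<close> by (simp add: V_def)
  qed (use U in \<open>auto simp: V_def dist_real_def\<close>)
qed

lemma tree_refl:
  assumes T: "tree_structure X s \<mu>" and y: "y \<in> topspace X"
  shows "\<mu> y y = s y"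
proof (rule antisym)
  show "\<mu> y y \<le> s y" using tree_le1[OF T y y] .
  show "s y \<le> \<mu> y y"
  proof (rule field_le_epsilon)
    fix e :: real assume "0 < e"
    then show "s y \<le> \<mu> y y + e" using tree_near[OF T y, of e] by force
  qed
qed

text \<open>Two uses of the ultrametric inequality replace y by a nearby a and z by a nearby b:
  \<open>\<mu> a b\<close> is at least the minimum of \<open>\<mu> a y\<close>,
  \<open>\<mu> y z\<close> and \<open>\<mu> z b\<close>, and the outer two almost reach
  \<open>s y\<close> and \<open>s z\<close>.\<close>

lemma tree_continuous:
  assumes T: "tree_structure X s \<mu>"
  shows "continuous_map (prod_topology X X) euclideanreal (\<lambda>p. \<mu> (fst p) (snd p))"
proof -
  have "\<exists>W. openin (prod_topology X X) W \<and> p \<in> W \<and>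
      (\<forall>q\<in>W. dist (\<mu> (fst q) (snd q)) (\<mu> (fst p) (snd p)) < \<epsilon>)"
    if p: "p \<in> topspace (prod_topology X X)" and "\<epsilon> > 0" for p \<epsilon>
  proof -
    obtain y z where yz: "p = (y, z)" "y \<in> topspace X" "z \<in> topspace X" using p by auto
    have e: "\<epsilon>/3 > 0" using \<open>\<epsilon> > 0\<close> by simp
    obtain U where U: "openin X U" "y \<in> U" "\<And>a b. a \<in> U \<Longrightarrow> b \<in> U \<Longrightarrow> s y - \<epsilon>/3 < \<mu> a b"
      "\<And>a. a \<in> U \<Longrightarrow> \<bar>s a - s y\<bar> < \<epsilon>/3"
      using tree_near_abs[OF T yz(2) e] by blast
    obtain V where V: "openin X V" "z \<in> V" "\<And>a b. a \<in> V \<Longrightarrow> b \<in> V \<Longrightarrow> s z - \<epsilon>/3 < \<mu> a b"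
      "\<And>a. a \<in> V \<Longrightarrow> \<bar>s a - s z\<bar> < \<epsilon>/3"
      using tree_near_abs[OF T yz(3) e] by blast
    have "dist (\<mu> a b) (\<mu> y z) < \<epsilon>" if ab: "a \<in> U" "b \<in> V" for a b
    proof -
      have t: "a \<in> topspace X" "b \<in> topspace X"
        using ab U(1) V(1) openin_subset by blast+
      have m: "\<mu> a b \<le> s a" "\<mu> a b \<le> s b" "\<mu> y z \<le> s y" "\<mu> y z \<le> s z"
        using tree_le1[OF T] tree_le2[OF T] t yz by blast+
      \<comment> \<open>In the reverse comparison \<open>\<mu> a b\<close> is bounded only by
        \<open>s a\<close> and \<open>s b\<close>, which may exceed \<open>s y\<close> and
        \<open>s z\<close> by \<open>\<epsilon>/3\<close>. Two thirds of \<open>\<epsilon>\<close>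
        are then lost, hence the choice of thirds.\<close>
      have sa: "s a < s y + \<epsilon>/3" "s b < s z + \<epsilon>/3"
        using U(4)[OF ab(1)] V(4)[OF ab(2)] by (simp_all only: abs_less_iff) linarith+
      have "\<mu> y z - \<epsilon> < min (\<mu> a y) (min (\<mu> y z) (\<mu> z b))"
        using U(3)[OF ab(1) U(2)] V(3)[OF V(2) ab(2)] m \<open>\<epsilon> > 0\<close> by simp
      moreover have "min (\<mu> a y) (min (\<mu> y z) (\<mu> z b)) \<le> \<mu> a b"
        using tree_ultra[OF T t(1) yz(2) t(2)] tree_ultra[OF T yz(2) yz(3) t(2)]
        by (meson min.mono order_refl order_trans)
      moreover have "\<mu> a b - \<epsilon> < min (\<mu> y a) (min (\<mu> a b) (\<mu> b z))"
        using U(3)[OF U(2) ab(1)] V(3)[OF ab(2) V(2)] m sa \<open>\<epsilon> > 0\<close> by simp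
      moreover have "min (\<mu> y a) (min (\<mu> a b) (\<mu> b z)) \<le> \<mu> y z"
        using tree_ultra[OF T yz(2) t(1) yz(3)] tree_ultra[OF T t(1) t(2) yz(3)]
        by (meson min.mono order_refl order_trans)
      ultimately have "\<mu> y z - \<epsilon> < \<mu> a b" "\<mu> a b - \<epsilon> < \<mu> y z" by (meson order.strict_trans2)+
      then show ?thesis by (simp add: dist_real_def abs_less_iff)
    qed
    then show ?thesis using U V yz
      by (intro exI[of _ "U \<times> V"]) (auto simp: openin_prod_Times_iff)
  qed
  then show ?thesis
    by (intro continuous_map_realI) blast
qed

lemma tree_uniform:
  fixes K :: "'a::metric_space set"
  assumes K: "compact K" and T: "tree_structure (top_of_set K) s \<mu>" and "\<epsilon> > 0"
  obtains \<theta> where "\<theta> > 0"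
    "\<And>y z. y \<in> K \<Longrightarrow> z \<in> K \<Longrightarrow> dist y z < \<theta> \<Longrightarrow> \<bar>s y - s z\<bar> < \<epsilon> \<and> s y - \<epsilon> < \<mu> y z"
proof -
  have e: "\<epsilon>/2 > 0" using \<open>\<epsilon> > 0\<close> by simp
  have "\<exists>G. open G \<and> x \<in> G \<and> (\<forall>y\<in>K \<inter> G. \<forall>z\<in>K \<inter> G. \<bar>s y - s z\<bar> < \<epsilon> \<and> s y - \<epsilon> < \<mu> y z)"
    if x: "x \<in> K" for x
  proof -
    obtain U where U: "openin (top_of_set K) U" "x \<in> U"
      and m: "\<And>z w. z \<in> U \<Longrightarrow> w \<in> U \<Longrightarrow> s x - \<epsilon>/2 < \<mu> z w"
      and a: "\<And>z. z \<in> U \<Longrightarrow> \<bar>s z - s x\<bar> < \<epsilon>/2"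
      using tree_near_abs[OF T _ e, of x] x by auto
    obtain G where G: "open G" "U = K \<inter> G"
      using U(1) by (auto simp: openin_open)
    have "\<bar>s y - s z\<bar> < \<epsilon> \<and> s y - \<epsilon> < \<mu> y z" if "y \<in> U" "z \<in> U" for y z
      using m[OF that] a[OF that(1)] a[OF that(2)] by (intro conjI) linarith+
    then show ?thesis using G U(2) by blast
  qed
  then obtain G where G: "\<And>x. x \<in> K \<Longrightarrow> open (G x)" "\<And>x. x \<in> K \<Longrightarrow> x \<in> G x"
    "\<And>x y z. x \<in> K \<Longrightarrow> y \<in> K \<inter> G x \<Longrightarrow> z \<in> K \<inter> G x \<Longrightarrow> \<bar>s y - s z\<bar> < \<epsilon> \<and> s y - \<epsilon> < \<mu> y z"
    by metis
  show thesis
  proof (cases "K = {}")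
    case True
    then show ?thesis using that[of 1] by simp
  next
    case False
    obtain \<delta> where "0 < \<delta>" and \<delta>: "\<And>T. \<lbrakk>T \<subseteq> K; diameter T < \<delta>\<rbrakk> \<Longrightarrow> \<exists>B \<in> G ` K. T \<subseteq> B"
      using Lebesgue_number_lemma[OF K, of "G ` K"] G False by blast
    show ?thesis
    proof (rule that[OF \<open>0 < \<delta>\<close>])
      fix y z assume yz: "y \<in> K" "z \<in> K" "dist y z < \<delta>"
      have "diameter {y, z} \<le> dist y z"
        unfolding diameter_def by (auto simp: dist_commute cSup_eq_Max)
      then obtain x where "x \<in> K" "{y, z} \<subseteq> G x"
        using \<delta>[of "{y, z}"] yz by auto
      then show "\<bar>s y - s z\<bar> < \<epsilon> \<and> s y - \<epsilon> < \<mu> y z" using G(3) yz by blast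
    qed
  qed
qed

lemma tree_uniform_family:
  fixes K :: "'a::metric_space set"
  assumes K: "compact K" and T: "\<And>i. i < m \<Longrightarrow> tree_structure (top_of_set K) (s i) (\<mu> i)"
    and "\<epsilon> > 0"
  obtains \<theta> where "\<theta> > 0"
    "\<And>i y z. i < (m::nat) \<Longrightarrow> y \<in> K \<Longrightarrow> z \<in> K \<Longrightarrow> dist y z < \<theta> \<Longrightarrow>
      \<bar>s i y - s i z\<bar> < \<epsilon> \<and> s i y - \<epsilon> < \<mu> i y z"
proof -
  have "\<forall>i. \<exists>\<theta>>0. i < m \<longrightarrow> (\<forall>y\<in>K. \<forall>z\<in>K. dist y z < \<theta> \<longrightarrow> \<bar>s i y - s i z\<bar> < \<epsilon> \<and> s i y - \<epsilon> < \<mu> i y z)"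
    using tree_uniform[OF K T \<open>\<epsilon> > 0\<close>] by (metis zero_less_one)
  then obtain \<theta> where \<theta>: "\<And>i. \<theta> i > 0"
    "\<And>i y z. i < m \<Longrightarrow> y \<in> K \<Longrightarrow> z \<in> K \<Longrightarrow> dist y z < \<theta> i \<Longrightarrow> \<bar>s i y - s i z\<bar> < \<epsilon> \<and> s i y - \<epsilon> < \<mu> i y z"
    by metis
  show thesis
  \<comment> \<open>The inserted 1 keeps the minimum defined for m = 0.\<close>
  proof (rule that[of "Min (insert 1 (\<theta> ` {..<m}))"])
    show "0 < Min (insert 1 (\<theta> ` {..<m}))" using \<theta>(1) by simp
  qed (use \<theta>(2) in simp)
qed

(* Colour j stands for the grid of levels shifted by j/(m+1).  A number is close to at most one of
   these m + 1 grids, so m numbers leave a grid to which none of them is close. *)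
lemma good_colour_exists:
  fixes t :: "nat \<Rightarrow> real"
  obtains j where "j \<le> m" "\<And>i. i < m \<Longrightarrow>
      1 / (4 * (real m + 1)) \<le> frac (t i - real j / (real m + 1)) \<and>
      frac (t i - real j / (real m + 1)) \<le> 1 - 1 / (4 * (real m + 1))"
proof -
  define M where "M = real m + 1"
  have M: "M > 0" by (simp add: M_def)
  define bad where "bad i j \<longleftrightarrow> \<not> (1 / (4 * M) \<le> frac (t i - real j / M) \<and>
      frac (t i - real j / M) \<le> 1 - 1 / (4 * M))" for i j
  have uniq: "j = j'" if u: "bad i j" "bad i j'" "j \<le> m" "j' \<le> m" for i j j'
  proof -
    have near: "\<exists>k::int. \<bar>t i - real j / M - of_int k\<bar> < 1 / (4 * M)" if "bad i j" for j
    proof -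
      let ?x = "t i - real j / M"
      from that consider "frac ?x < 1 / (4 * M)" | "frac ?x > 1 - 1 / (4 * M)"
        unfolding bad_def by linarith
      then show ?thesis
      proof cases
        case 1
        then show ?thesis using frac_ge_0[of ?x]
          by (intro exI[of _ "\<lfloor>?x\<rfloor>"]) (simp add: frac_def)
      next
        case 2
        then show ?thesis using frac_lt_1[of ?x] M
          by (intro exI[of _ "\<lfloor>?x\<rfloor> + 1"]) (simp add: frac_def abs_less_iff)
      qed
    qed
    obtain k k' :: int where k: "\<bar>t i - real j / M - of_int k\<bar> < 1 / (4 * M)"
      "\<bar>t i - real j' / M - of_int k'\<bar> < 1 / (4 * M)"
      using near[OF u(1)] near[OF u(2)] by blast
    \<comment> \<open>Multiplied by M this becomes an integer of absolute value below 1, so it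
      vanishes. As j and j' differ by less than m + 1, the integer \<open>k' - k\<close> is then 0
      and the colours coincide.\<close>
    have "\<bar>(real j' / M - real j / M) + (of_int k' - of_int k)\<bar> < 2 * (1 / (4 * M))"
      using k by linarith
    from mult_strict_right_mono[OF this M]
    have "\<bar>(real j' / M - real j / M) + (of_int k' - of_int k)\<bar> * M < 2 * (1 / (4 * M)) * M" .
    also have "2 * (1 / (4 * M)) * M < 1" using M by simp
    also have "\<bar>(real j' / M - real j / M) + (of_int k' - of_int k)\<bar> * M
        = \<bar>((real j' / M - real j / M) + (of_int k' - of_int k)) * M\<bar>"
      using M by (simp add: abs_mult)
    also have "((real j' / M - real j / M) + (of_int k' - of_int k)) * M
        = real j' - real j + (of_int k' - of_int k) * M"
      using M by (simp add: field_simps)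
    also have "\<dots> = of_int (int j' - int j + (k' - k) * int (m + 1))"
      by (simp add: M_def)
    finally have "\<bar>int j' - int j + (k' - k) * int (m + 1)\<bar> < 1" by linarith
    then have *: "int j - int j' = (k' - k) * int (m + 1)" by linarith
    have "\<bar>int j - int j'\<bar> < int (m + 1)" using u(3,4) by linarith
    then have "k' - k = 0"
      using * by (metis abs_mult abs_of_nat mult_less_cancel_right1 mult_le_cancel_right1
          abs_zero int_one_le_iff_zero_less not_less zero_less_abs_iff of_nat_0_le_iff)
    then show "j = j'" using * by simp
  qed
  have "\<exists>j\<le>m. \<forall>i<m. \<not> bad i j"
  proof (rule ccontr)
    assume "\<not> ?thesis"
    then obtain f where f: "\<And>j. j \<le> m \<Longrightarrow> f j < m \<and> bad (f j) j" by metis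
    have "inj_on f {..m}" using f uniq by (metis atMost_iff inj_onI)
    moreover have "f ` {..m} \<subseteq> {..<m}" using f by auto
    ultimately have "card {..m} \<le> card {..<m}" by (metis card_inj_on_le finite_lessThan)
    then show False by simp
  qed
  then show thesis using that unfolding bad_def M_def by blast
qed


text \<open>If the conclusion fails, the face \<open>y j = 0\<close> can be enlarged by the pieces
  of colour j that come close to it: the pieces are too small to reach the opposite face, and
  different pieces of one colour are uniformly apart. So the enlarged face \<open>A j\<close> is
  surrounded by a gap that contains no point of \<open>C j\<close>. Kuhn's lemma yields a point in
  all these gaps at once, but every point lies in some \<open>C j\<close>.\<close>

lemma tree_lebesgue_approx:
  assumes T: "\<And>i. i < m \<Longrightarrow> tree_structure (top_of_set (unit_cube (Suc m))) (s i) (\<mu> i)"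
    and "\<eta> > 0"
  obtains k y z where "k \<le> m" "y \<in> unit_cube (Suc m)" "z \<in> unit_cube (Suc m)" "y k = 0" "z k = 1"
    "\<And>i. i < m \<Longrightarrow> s i y + s i z - 2 * \<mu> i y z < \<eta>"
proof (rule ccontr)
  note main = that
  assume "\<not> thesis"
  let ?K = "unit_cube (Suc m)"
  have sep: "\<exists>i<m. \<eta> \<le> s i y + s i z - 2 * \<mu> i y z"
    if "k \<le> m" "y \<in> ?K" "z \<in> ?K" "y k = 0" "z k = 1" for k y z
  proof (rule ccontr)
    assume "\<not> ?thesis"
    then show False using \<open>\<not> thesis\<close> main[OF that] by (simp add: not_le)
  qed
  define M where "M = real m + 1"
  define \<gamma> where "\<gamma> = 1 / (4 * M)"
  \<comment> \<open>The contradictions below need only that points closer than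
    \<open>\<theta>\<close>, and points near one piece, are less than \<open>3 * \<delta>\<close>
    apart in each tree; the 10 leaves room.\<close>
  define \<delta> where "\<delta> = \<eta> / 10"
  define g where "g = \<delta> * \<gamma>"
  have M: "M \<ge> 1" by (simp add: M_def)
  have \<gamma>: "0 < \<gamma>" "\<gamma> < 1" using M by (auto simp: \<gamma>_def)
  have \<delta>: "\<delta> > 0" using \<open>\<eta> > 0\<close> by (simp add: \<delta>_def)
  have g: "0 < g" "g < \<delta>" using \<gamma> \<delta> by (auto simp: g_def)
  obtain \<theta> where "\<theta> > 0" and \<theta>: "\<And>i y z. i < m \<Longrightarrow> y \<in> ?K \<Longrightarrow> z \<in> ?K \<Longrightarrow> dist y z < \<theta> \<Longrightarrow>
      \<bar>s i y - s i z\<bar> < g \<and> s i y - g < \<mu> i y z"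
    using tree_uniform_family[OF compact_unit_cube _ g(1), where s = s and \<mu> = \<mu> and m = m] T
    by blast
  \<comment> \<open>\<open>base i j y\<close> is the highest level of grid j not above the image of
    y in tree i. Points of \<open>C j\<close> keep the distance g from the grid, and
    \<open>rel j\<close> says that two points are above the same levels on the same branches, that
    is, in one piece of colour j.\<close>
  define base where "base i j y = \<delta> * (of_int \<lfloor>s i y / \<delta> - real j / M\<rfloor> + real j / M)"
    for i and j :: nat and y :: "nat \<Rightarrow> real"
  define C where "C j = {y \<in> ?K. \<forall>i<m. \<gamma> \<le> frac (s i y / \<delta> - real j / M) \<and>
      frac (s i y / \<delta> - real j / M) \<le> 1 - \<gamma>}" for j :: nat
  define rel where "rel j y z \<longleftrightarrow> (\<forall>i<m. base i j y = base i j z \<and> base i j y \<le> \<mu> i y z)"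
    for j y z
  define A where "A j = {y \<in> ?K. y j = 0} \<union>
      {y \<in> C j. \<exists>z\<in>C j. \<exists>w\<in>?K. w j = 0 \<and> dist z w < \<theta> \<and> rel j y z}" for j
  have C_K: "y \<in> ?K" if "y \<in> C j" for y j using that by (simp add: C_def)
  have height: "base i j y + g \<le> s i y" "s i y \<le> base i j y + \<delta> - g" if "y \<in> C j" "i < m" for i j y
  proof -
    have "s i y = base i j y + \<delta> * frac (s i y / \<delta> - real j / M)"
      using \<delta> by (simp add: base_def frac_def field_simps)
    moreover have "\<delta> * \<gamma> \<le> \<delta> * frac (s i y / \<delta> - real j / M)"
      "\<delta> * frac (s i y / \<delta> - real j / M) \<le> \<delta> * (1 - \<gamma>)"
      using that \<delta> by (auto simp: C_def intro!: mult_left_mono)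
    ultimately show "base i j y + g \<le> s i y" "s i y \<le> base i j y + \<delta> - g"
      by (simp_all add: g_def right_diff_distrib)
  qed
  \<comment> \<open>A change of height by less than g, from a height at least g away from the grid,
    cannot cross a grid level.\<close>
  have close: "rel j y z" if "y \<in> C j" "z \<in> C j" "dist y z < \<theta>" for j y z
    unfolding rel_def
  proof (intro allI impI conjI)
    fix i assume i: "i < m"
    let ?x = "s i y / \<delta> - real j / M" and ?x' = "s i z / \<delta> - real j / M"
    have b: "\<bar>s i y - s i z\<bar> < g" "s i y - g < \<mu> i y z"
      using \<theta>[OF i C_K[OF that(1)] C_K[OF that(2)] that(3)] by auto
    have "\<bar>?x - ?x'\<bar> = \<bar>s i y - s i z\<bar> / \<delta>"
      using \<delta> by (simp add: abs_divide flip: diff_divide_distrib)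
    also have "\<dots> < \<gamma>" using b(1) \<delta> by (simp add: g_def divide_less_eq mult.commute)
    finally have "\<bar>?x - ?x'\<bar> < \<gamma>" .
    moreover have "\<gamma> \<le> ?x - of_int \<lfloor>?x\<rfloor>" "?x - of_int \<lfloor>?x\<rfloor> \<le> 1 - \<gamma>"
      using that(1) i by (auto simp: C_def frac_def)
    ultimately have "\<lfloor>?x'\<rfloor> = \<lfloor>?x\<rfloor>" by (intro floor_unique) linarith+
    then show "base i j y = base i j z" by (simp add: base_def)
    show "base i j y \<le> \<mu> i y z" using b(2) height(1)[OF that(1) i] by linarith
  qed
  have rel_trans: "rel j y z" if "rel j y x" "rel j x z" "x \<in> ?K" "y \<in> ?K" "z \<in> ?K" for j x y z
    using that tree_ultra[OF T, of _ y x z] unfolding rel_def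
    by (fastforce intro: order_trans)
  have apart: "\<theta> \<le> dist y y'"
    if y: "y \<in> A j" and y': "y' \<in> ?K" "y' j = 1 \<or> y' \<in> C j \<and> y' \<notin> A j" and "j \<le> m" for j y y'
  proof (rule ccontr)
    assume "\<not> \<theta> \<le> dist y y'"
    then have d: "dist y y' < \<theta>" "dist y' y < \<theta>" by (auto simp: dist_commute)
    have yK: "y \<in> ?K" using y C_K by (auto simp: A_def)
    consider (ff) "y j = 0" "y' j = 1" | (fc) "y j = 0" "y' \<in> C j" "y' \<notin> A j"
      | z w where "y \<in> C j" "z \<in> C j" "w \<in> ?K" "w j = 0" "dist z w < \<theta>" "rel j y z" "y' j = 1"
      | (cc) z w where "y \<in> C j" "z \<in> C j" "w \<in> ?K" "w j = 0" "dist z w < \<theta>" "rel j y z" "y' \<in> C j" "y' \<notin> A j"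
      using y y' by (auto simp: A_def)
    then show False
    proof cases
      case ff
      obtain i where "i < m" "\<eta> \<le> s i y + s i y' - 2 * \<mu> i y y'"
        using sep[OF \<open>j \<le> m\<close> yK y'(1) ff] by blast
      then show False
        using \<theta>[OF \<open>i < m\<close> yK y'(1) d(1)] g \<delta> unfolding \<delta>_def by linarith
    next
      case fc
      have "rel j y' y'" using close[OF fc(2,2)] \<open>\<theta> > 0\<close> by simp
      then have "y' \<in> A j" using fc yK d by (auto simp: A_def)
      with fc show False by blast
    next
      \<comment> \<open>The chain w, z, y, y' leads from one face to the other. Each consecutive
        pair parts at or above the level \<open>base i j y\<close>, and the heights of w and y'
        exceed that level by at most \<open>\<delta>\<close>.\<close>
      case (3 z w)
      have zK: "z \<in> ?K" using 3 C_K by blast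
      obtain i where i: "i < m" "\<eta> \<le> s i w + s i y' - 2 * \<mu> i w y'"
        using sep[OF \<open>j \<le> m\<close> \<open>w \<in> ?K\<close> y'(1) 3(4,7)] by blast
      have "base i j y = base i j z" "base i j y \<le> \<mu> i z y"
        using 3(6) i tree_sym[OF T[OF i(1)], of y z] yK zK by (auto simp: rel_def)
      moreover have "\<bar>s i y' - s i y\<bar> < g" "s i y - g < \<mu> i y y'" "\<bar>s i z - s i w\<bar> < g" "s i z - g < \<mu> i w z"
        using \<theta>[OF i(1) yK y'(1) d(1)] \<theta>[OF i(1) zK 3(3,5)] tree_sym[OF T[OF i(1)], of w z] zK 3(3)
        by auto
      moreover have "min (\<mu> i w z) (\<mu> i z y) \<le> \<mu> i w y" "min (\<mu> i w y) (\<mu> i y y') \<le> \<mu> i w y'"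
        using tree_ultra[OF T[OF i(1)]] yK y'(1) zK 3(3) by simp_all
      ultimately show False
        using height[OF 3(1) i(1)] height[OF 3(2) i(1)] i(2) g \<delta> unfolding \<delta>_def min_le_iff_disj
        by (elim disjE) linarith+
    next
      case (cc z w)
      have "rel j y' y" using close[OF cc(7,1)] d by simp
      then have "rel j y' z" using rel_trans[OF _ cc(6)] cc C_K by blast
      then have "y' \<in> A j" using cc by (auto simp: A_def)
      with cc show False by blast
    qed
  qed
  define L where "L j r \<longleftrightarrow> (\<exists>y\<in>A j. dist y r < \<theta> / 2)" for j r
  obtain y where yK: "y \<in> ?K" and rs: "\<And>j. j < Suc m \<Longrightarrow> \<exists>r\<in>?K. \<exists>s\<in>?K.
      (\<forall>i. \<bar>r i - y i\<bar> < \<theta>/8) \<and> (\<forall>i. \<bar>s i - y i\<bar> < \<theta>/8) \<and> L j r \<and> \<not> L j s"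
  proof (rule kuhn_unit_cube[of "Suc m" L "\<theta>/8"])
    show "L j y" if "y \<in> ?K" "y j = 0" for j y
      using that \<open>\<theta> > 0\<close> by (auto simp: L_def A_def intro!: bexI[of _ y])
    show "\<not> L j y" if "j < Suc m" "y \<in> ?K" "y j = 1" for j y
    proof
      assume "L j y"
      then obtain a where "a \<in> A j" "dist a y < \<theta>/2" by (auto simp: L_def)
      with apart[of a j y] that \<open>\<theta> > 0\<close> show False by simp
    qed
  qed (use \<open>\<theta> > 0\<close> in auto)
  obtain j where j: "j \<le> m" "\<And>i. i < m \<Longrightarrow> \<gamma> \<le> frac (s i y / \<delta> - real j / M) \<and>
      frac (s i y / \<delta> - real j / M) \<le> 1 - \<gamma>"
    using good_colour_exists[of m "\<lambda>i. s i y / \<delta>"] unfolding M_def \<gamma>_def by blast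
  then have yC: "y \<in> C j" using yK by (simp add: C_def)
  obtain r s' where rs: "r \<in> ?K" "s' \<in> ?K" "\<forall>i. \<bar>r i - y i\<bar> < \<theta>/8" "\<forall>i. \<bar>s' i - y i\<bar> < \<theta>/8"
    "L j r" "\<not> L j s'"
    using rs[of j] j(1) by auto
  \<comment> \<open>An error of \<open>\<theta>/8\<close> in the coordinates is at most
    \<open>\<theta>/4\<close> in the metric, below the width \<open>\<theta> / 2\<close> of the
    neighbourhoods in \<open>L\<close>.\<close>
  have "dist r y \<le> 2 * (\<theta>/8)" "dist s' y \<le> 2 * (\<theta>/8)"
    using rs by (intro dist_fun_le_coordinates; simp add: less_imp_le)+
  then have dd: "dist r y < \<theta>/2" "dist y s' < \<theta>/2"
    using \<open>\<theta> > 0\<close> by (auto simp: dist_commute)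
  \<comment> \<open>The point \<open>s'\<close> keeps y out of \<open>A j\<close>, while r brings
    \<open>A j\<close> closer than \<open>\<theta>\<close> to y. As y is in \<open>C j\<close>, this
    contradicts \<open>apart\<close>.\<close>
  have "y \<notin> A j" using rs(6) dd by (auto simp: L_def)
  obtain a where a: "a \<in> A j" "dist a r < \<theta>/2" using rs(5) by (auto simp: L_def)
  have "\<theta> \<le> dist a y" using apart[OF a(1) yK _ j(1)] yC \<open>y \<notin> A j\<close> by blast
  then show False using dist_triangle[of a y r] a dd by linarith
qed

section \<open>Cells in a product of trees\<close>

text \<open>Both heights being at most \<open>\<mu> i y z\<close> means that y and z have the same
  image in tree i. The sum \<open>F\<close> of the tree distances is continuous on the compact sets
  \<open>P k\<close>; if it had no zero there, it would have a positive lower bound, against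
  \<open>tree_lebesgue_approx\<close>.\<close>

lemma tree_lebesgue:
  assumes T: "\<And>i. i < m \<Longrightarrow> tree_structure (top_of_set (unit_cube (Suc m))) (s i) (\<mu> i)"
  obtains k y z where "k \<le> m" "y \<in> unit_cube (Suc m)" "z \<in> unit_cube (Suc m)" "y k = 0" "z k = 1"
    "\<And>i. i < m \<Longrightarrow> s i y \<le> \<mu> i y z \<and> s i z \<le> \<mu> i y z"
proof (rule ccontr)
  note main = that
  assume neg: "\<not> thesis"
  let ?K = "unit_cube (Suc m)"
  define F where "F p = (\<Sum>i<m. s i (fst p) + s i (snd p) - 2 * \<mu> i (fst p) (snd p))" for p
  define P where "P k = {y \<in> ?K. y k = 0} \<times> {z \<in> ?K. z k = 1}" for k
  have term0: "0 \<le> s i y + s i z - 2 * \<mu> i y z" if "i < m" "y \<in> ?K" "z \<in> ?K" for i y z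
    using tree_le1[OF T, of i y z] tree_le2[OF T, of i y z] that by simp
  have P_K: "P k \<subseteq> ?K \<times> ?K" for k by (auto simp: P_def)
  have comp: "compact (P k)" for k
  proof -
    have "compact (?K \<inter> {y. y k = c})" for c :: real
      by (intro compact_Int_closed compact_unit_cube closed_Collect_eq continuous_on_const
          continuous_on_product_coordinates)
    moreover have "P k = (?K \<inter> {y. y k = 0}) \<times> (?K \<inter> {y. y k = 1})" by (auto simp: P_def)
    ultimately show ?thesis by (simp add: compact_Times)
  qed
  have "continuous_on (?K \<times> ?K) F"
  proof -
    have "continuous_on (?K \<times> ?K) (\<lambda>p. \<mu> i (fst p) (snd p))" if "i < m" for i
      using tree_continuous[OF T[OF that]] by (simp add: prod_topology_subtopology_eu)
    moreover have "continuous_on ?K (s i)" if "i < m" for i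
      using tree_cont[OF T[OF that]] by simp
    then have "continuous_on (?K \<times> ?K) (\<lambda>p. s i (fst p))" "continuous_on (?K \<times> ?K) (\<lambda>p. s i (snd p))"
      if "i < m" for i
      by (rule continuous_on_compose2[of ?K "s i", OF _ continuous_on_fst[OF continuous_on_id]]
          continuous_on_compose2[of ?K "s i", OF _ continuous_on_snd[OF continuous_on_id]];
          use that in force)+
    ultimately show ?thesis unfolding F_def by (intro continuous_intros) auto
  qed
  then have contF: "continuous_on (P k) F" for k using P_K continuous_on_subset by blast
  have pos: "0 < F p" if kp: "k \<le> m" "p \<in> P k" for k p
  proof -
    obtain y z where p: "p = (y, z)" "y \<in> ?K" "z \<in> ?K" "y k = 0" "z k = 1"
      using kp(2) by (auto simp: P_def)
    obtain i where i: "i < m" "\<not> (s i y \<le> \<mu> i y z \<and> s i z \<le> \<mu> i y z)"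
      using neg main[OF kp(1) p(2-5)] by blast
    then have "0 < s i y + s i z - 2 * \<mu> i y z"
      using tree_le1[OF T, of i y z] tree_le2[OF T, of i y z] p by auto
    then show ?thesis using i(1) p term0 unfolding F_def
      by (intro sum_pos2[of _ i]) auto
  qed
  have "\<exists>\<eta>>0. \<forall>p\<in>P k. \<eta> \<le> F p" if "k \<le> m" for k
  proof (cases "P k = {}")
    case False
    then obtain q where "q \<in> P k" "\<forall>p\<in>P k. F q \<le> F p"
      using continuous_attains_inf[OF comp False contF] by blast
    then show ?thesis using pos[OF that] by blast
  qed (auto intro: zero_less_one)
  then have "\<forall>k. \<exists>\<eta>. k \<le> m \<longrightarrow> \<eta> > 0 \<and> (\<forall>p\<in>P k. \<eta> \<le> F p)" by blast
  from choice[OF this] obtain \<eta> where "\<forall>k\<le>m. \<eta> k > 0 \<and> (\<forall>p\<in>P k. \<eta> k \<le> F p)" by blast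
  then have \<eta>: "\<And>k. k \<le> m \<Longrightarrow> \<eta> k > 0" "\<And>k p. k \<le> m \<Longrightarrow> p \<in> P k \<Longrightarrow> \<eta> k \<le> F p"
    by blast+
  define \<eta>0 where "\<eta>0 = Min (\<eta> ` {..m})"
  have \<eta>0: "\<eta>0 > 0" "\<And>k. k \<le> m \<Longrightarrow> \<eta>0 \<le> \<eta> k" using \<eta>(1) by (auto simp: \<eta>0_def)
  \<comment> \<open>Dividing by m + 1 makes the sum of the m terms strictly smaller than
    \<open>\<eta>0\<close>, also for m = 0.\<close>
  have pos': "0 < \<eta>0 / (real m + 1)" using \<eta>0(1) by simp
  obtain k y z where kyz: "k \<le> m" "y \<in> ?K" "z \<in> ?K" "y k = 0" "z k = 1"
    "\<And>i. i < m \<Longrightarrow> s i y + s i z - 2 * \<mu> i y z < \<eta>0 / (real m + 1)"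
    by (rule tree_lebesgue_approx[where m = m, OF T pos']) blast+
  have "F (y, z) \<le> (\<Sum>i<m. \<eta>0 / (real m + 1))"
    unfolding F_def using kyz(6) by (intro sum_mono) (auto simp: less_imp_le)
  also have "\<dots> < \<eta>0" using \<eta>0(1) by (simp add: field_simps)
  finally show False
    using \<eta>(2)[OF kyz(1), of "(y, z)"] \<eta>0(2)[OF kyz(1)] kyz by (simp add: P_def)
qed

text \<open>The image of \<open>f y\<close> slides down its branch until its height is multiplied by
  \<open>c y\<close>. Two shortened branches agree up to where the old ones part or up to the end of
  the shorter one, hence the \<open>min\<close>. Nonnegative heights make the multiplication a
  descent.\<close>

lemma tree_pullback_scaled:
  assumes T: "tree_structure X s \<mu>" and f: "continuous_map Y X f"
    and c: "continuous_map Y euclideanreal c"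
    and c01: "\<And>y. y \<in> topspace Y \<Longrightarrow> 0 \<le> c y \<and> c y \<le> 1"
    and pos: "\<And>x. x \<in> topspace X \<Longrightarrow> 0 \<le> s x"
  shows "tree_structure Y (\<lambda>y. s (f y) * c y)
    (\<lambda>y z. min (min (s (f y) * c y) (s (f z) * c z)) (\<mu> (f y) (f z)))"
proof -
  have ft: "f y \<in> topspace X" if "y \<in> topspace Y" for y
    using f that by (auto simp: continuous_map_def)
  have cs: "continuous_map Y euclideanreal (\<lambda>y. s (f y) * c y)"
    using continuous_map_compose[OF f tree_cont[OF T]] c
    by (intro continuous_map_real_mult) (auto simp: o_def)
  have near: "\<exists>U. openin Y U \<and> y \<in> U \<and> (\<forall>z\<in>U. \<forall>w\<in>U. s (f y) * c y - \<epsilon> <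
        min (min (s (f z) * c z) (s (f w) * c w)) (\<mu> (f z) (f w)))"
    if y: "y \<in> topspace Y" and "\<epsilon> > 0" for y \<epsilon>
  proof -
    obtain U where U: "openin X U" "f y \<in> U" "\<forall>z\<in>U. \<forall>w\<in>U. s (f y) - \<epsilon> < \<mu> z w"
      using tree_near[OF T ft[OF y] \<open>\<epsilon> > 0\<close>] by blast
    define V where "V = {z \<in> topspace Y. f z \<in> U} \<inter>
        {z \<in> topspace Y. s (f z) * c z \<in> {s (f y) * c y - \<epsilon><..}}"
    have "openin Y V" unfolding V_def
      by (intro openin_Int openin_continuous_map_preimage[OF f U(1)]
          openin_continuous_map_preimage[OF cs]) auto
    moreover have "y \<in> V" using y U \<open>\<epsilon> > 0\<close> by (simp add: V_def)
    moreover have "s (f y) * c y \<le> s (f y)"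
      using pos[OF ft[OF y]] c01[OF y] by (simp add: mult_left_le)
    then have "s (f y) * c y - \<epsilon> < \<mu> (f z) (f w)" if "z \<in> V" "w \<in> V" for z w
      using U(3) that by (fastforce simp: V_def)
    ultimately show ?thesis by (intro exI[of _ V]) (auto simp: V_def)
  qed
  have ultra: "min (min (min a b) m1) (min (min b d) m2) \<le> min (min a d) m3"
    if "min m1 m2 \<le> m3" for a b d m1 m2 m3 :: real
    using that by (auto simp: min_def split: if_splits)
  show ?thesis unfolding tree_structure_def
  proof (intro conjI ballI allI impI)
    show "min (min (s (f y) * c y) (s (f z) * c z)) (\<mu> (f y) (f z)) =
        min (min (s (f z) * c z) (s (f y) * c y)) (\<mu> (f z) (f y))"
      if "y \<in> topspace Y" "z \<in> topspace Y" for y z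
      using tree_sym[OF T ft[OF that(1)] ft[OF that(2)]] by (simp add: min.commute)
    show "min (min (min (s (f y) * c y) (s (f z) * c z)) (\<mu> (f y) (f z)))
        (min (min (s (f z) * c z) (s (f w) * c w)) (\<mu> (f z) (f w)))
        \<le> min (min (s (f y) * c y) (s (f w) * c w)) (\<mu> (f y) (f w))"
      if "y \<in> topspace Y" "z \<in> topspace Y" "w \<in> topspace Y" for y z w
      using tree_ultra[OF T ft[OF that(1)] ft[OF that(2)] ft[OF that(3)]] by (rule ultra)
  qed (use cs near in simp_all)
qed


section \<open>Peaks of a cell in a product of trees\<close>

definition sym_cube :: "nat \<Rightarrow> (nat \<Rightarrow> real) set" where
  "sym_cube m = {b. (\<forall>i<m. \<bar>b i\<bar> \<le> 1) \<and> (\<forall>i\<ge>m. b i = 0)}"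

lemma compact_sym_cube: "compact (sym_cube m)"
proof -
  have "b \<in> sym_cube m \<longleftrightarrow> (\<forall>i. b i \<in> (if i < m then {-1..1} else {0}))" for b
    by (auto simp: sym_cube_def not_less abs_le_iff)
  then have "sym_cube m = PiE UNIV (\<lambda>i. if i < m then {-1..1} else {0})"
    by (simp only: PiE_UNIV_domain Pi_def set_eq_iff mem_Collect_eq UNIV_I simp_thms)
  moreover have "compactin (powertop_real UNIV) (PiE UNIV (\<lambda>i. if i < m then {-1..1::real} else {0}))"
    by (subst compactin_PiE) auto
  ultimately show ?thesis
    by (simp add: euclidean_product_topology)
qed

lemma sym_cube_zero: "(\<lambda>_. 0) \<in> sym_cube m"
  by (simp add: sym_cube_def)

lemma sym_cube_scale: "b \<in> sym_cube m \<Longrightarrow> 0 \<le> r \<Longrightarrow> r \<le> 1 \<Longrightarrow> (\<lambda>i. r * b i) \<in> sym_cube m"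
  by (auto simp: sym_cube_def abs_mult intro: mult_le_one)

text \<open>On the cube this product is a cutoff function, 1 at the centre and 0 on the boundary.
  One minus it is the factor by which heights are lowered when the cell is pushed towards the
  roots.\<close>

lemma face_product_bounds:
  assumes "b \<in> sym_cube m"
  shows "0 \<le> (\<Prod>i<m. 1 - (b i)\<^sup>2)" "(\<Prod>i<m. 1 - (b i)\<^sup>2) \<le> 1"
  using assms by (auto simp: sym_cube_def abs_le_square_iff[of _ "1::real", simplified]
      intro!: prod_nonneg prod_le_1)

text \<open>The disjunction means that in some tree the shrunk point is not below c after the push.
  With the centre as the shrunk point, this is the peak condition if c is not the centre, and if c
  is the centre the push takes it to height 0. Compactness in c and uniform continuity extend this
  to some positive r.\<close>

lemma tree_product_inner_radius:
  assumes T: "\<And>i. i < m \<Longrightarrow> tree_structure (top_of_set (sym_cube m)) (h i) (\<mu> i)"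
    and pos: "\<And>i b c. i < m \<Longrightarrow> b \<in> sym_cube m \<Longrightarrow> c \<in> sym_cube m \<Longrightarrow> 0 \<le> \<mu> i b c"
    and "m > 0"
    and peak: "\<And>b. b \<in> sym_cube m \<Longrightarrow> b \<noteq> (\<lambda>_. 0) \<Longrightarrow> \<exists>i<m. \<mu> i (\<lambda>_. 0) b < h i (\<lambda>_. 0)"
  obtains r where "0 < r" "r < 1"
    "\<And>b c. b \<in> sym_cube m \<Longrightarrow> c \<in> sym_cube m \<Longrightarrow>
      \<exists>i<m. \<mu> i (\<lambda>i. r * b i) c < h i (\<lambda>i. r * b i) \<or>
        h i c * (1 - (\<Prod>i<m. 1 - (c i)\<^sup>2)) < h i (\<lambda>i. r * b i)"
proof -
  let ?K = "sym_cube m" and ?N = "\<lambda>c. 1 - (\<Prod>i<m. 1 - (c i)\<^sup>2)"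
  let ?o = "\<lambda>_::nat. 0::real"
  \<comment> \<open>Each summand adds two nonnegative defects, one for each alternative in the
    conclusion, so \<open>0 < G p\<close> expresses the conclusion at p.\<close>
  define G where "G p = (\<Sum>i<m. (h i (fst p) - \<mu> i (fst p) (snd p)) +
      max 0 (h i (fst p) - h i (snd p) * ?N (snd p)))" for p
  have le: "\<mu> i b c \<le> h i b" if "i < m" "b \<in> ?K" "c \<in> ?K" for i b c
    using tree_le1[OF T] that by simp
  have contG: "continuous_on (?K \<times> ?K) G"
  proof -
    have "continuous_on (?K \<times> ?K) (\<lambda>p. \<mu> i (fst p) (snd p))" if "i < m" for i
      using tree_continuous[OF T[OF that]] by simp
    moreover have ch: "continuous_on ?K (h i)" if "i < m" for i
      using tree_cont[OF T[OF that]] by simp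
    have "continuous_on (?K \<times> ?K) (\<lambda>p. h i (fst p))" if "i < m" for i
      by (rule continuous_on_compose2[OF ch[OF that] continuous_on_fst[OF continuous_on_id]]) force
    moreover have "continuous_on (?K \<times> ?K) (\<lambda>p. h i (snd p))" if "i < m" for i
      by (rule continuous_on_compose2[OF ch[OF that] continuous_on_snd[OF continuous_on_id]]) force
    moreover have "continuous_on (?K \<times> ?K) (\<lambda>p. snd p i)" for i
      by (rule continuous_on_compose2[OF continuous_on_product_coordinates continuous_on_snd[OF continuous_on_id]]) auto
    ultimately show ?thesis unfolding G_def
      by (intro continuous_on_sum continuous_on_add continuous_on_diff continuous_on_max
          continuous_on_mult continuous_on_prod continuous_on_power continuous_on_const) auto
  qed
  have G0: "0 < G (?o, c)" if c: "c \<in> ?K" for c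
  proof -
    have "\<exists>i<m. 0 < (h i ?o - \<mu> i ?o c) + max 0 (h i ?o - h i c * ?N c)"
    proof (cases "c = ?o")
      case False
      then obtain i where "i < m" "\<mu> i ?o c < h i ?o" using peak c by blast
      then show ?thesis by (intro exI[of _ i]) auto
    next
      case True
      \<comment> \<open>Any point other than the centre shows, through the peak condition and
        \<open>pos\<close>, that some height at the centre is positive.\<close>
      define b :: "nat \<Rightarrow> real" where "b = (\<lambda>i. if i = 0 then 1 else 0)"
      have b: "b \<in> ?K" "b \<noteq> ?o" using \<open>m > 0\<close> by (auto simp: b_def sym_cube_def fun_eq_iff)
      then obtain i where i: "i < m" "\<mu> i ?o b < h i ?o" using peak by blast
      then have "0 < h i ?o" using pos[OF i(1) sym_cube_zero b(1)] by linarith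
      then show ?thesis using True le[OF i(1) sym_cube_zero c] i(1) by (intro exI[of _ i]) auto
    qed
    then obtain i where i: "i < m" "0 < (h i ?o - \<mu> i ?o c) + max 0 (h i ?o - h i c * ?N c)" by blast
    show ?thesis unfolding G_def
    proof (rule sum_pos2[of _ i])
      show "0 \<le> h j (fst (?o, c)) - \<mu> j (fst (?o, c)) (snd (?o, c)) +
          max 0 (h j (fst (?o, c)) - h j (snd (?o, c)) * ?N (snd (?o, c)))" if "j \<in> {..<m}" for j
        using le[of j ?o c] c sym_cube_zero that by auto
    qed (use i in auto)
  qed
  have "compact ({?o} \<times> ?K)" by (intro compact_Times compact_sym_cube) auto
  moreover have "{?o} \<times> ?K \<noteq> {}" using sym_cube_zero by blast
  moreover have "continuous_on ({?o} \<times> ?K) G"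
    by (rule continuous_on_subset[OF contG]) (use sym_cube_zero in auto)
  ultimately obtain q where q: "q \<in> {?o} \<times> ?K" "\<forall>p\<in>{?o} \<times> ?K. G q \<le> G p"
    using continuous_attains_inf by blast
  have "0 < G q" using q(1) G0 by auto
  moreover have "uniformly_continuous_on (?K \<times> ?K) G"
    by (intro compact_uniformly_continuous contG compact_Times compact_sym_cube)
  ultimately obtain d where "d > 0" and d: "\<And>p p'. p \<in> ?K \<times> ?K \<Longrightarrow> p' \<in> ?K \<times> ?K \<Longrightarrow>
      dist p' p < d \<Longrightarrow> dist (G p') (G p) < G q"
    unfolding uniformly_continuous_on_def by blast
  \<comment> \<open>Points of the cell shrunk by r are within \<open>2 * r\<close> of the centre,
    the factor being that of \<open>dist_fun_le_coordinates\<close>.\<close>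
  define r where "r = min (1/2) (d/4)"
  have r: "0 < r" "r < 1" "2 * r < d" using \<open>d > 0\<close> by (auto simp: r_def)
  show thesis
  proof (rule that[OF r(1,2)])
    fix b c assume bc: "b \<in> ?K" "c \<in> ?K"
    let ?rb = "\<lambda>i. r * b i"
    have rb: "?rb \<in> ?K" using sym_cube_scale[OF bc(1)] r by simp
    have "\<bar>r * b i - 0\<bar> \<le> r" for i
      using bc(1) r(1) by (cases "i < m") (auto simp: sym_cube_def abs_mult mult_left_le)
    then have "dist ?rb ?o \<le> 2 * r" by (rule dist_fun_le_coordinates)
    then have "dist (?rb, c) (?o, c) < d" using r(3) by (simp add: dist_Pair_Pair)
    then have "dist (G (?rb, c)) (G (?o, c)) < G q"
      using d bc(2) rb sym_cube_zero by blast
    moreover have "G q \<le> G (?o, c)" using q(2) bc(2) by blast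
    ultimately have "0 < G (?rb, c)" by (auto simp: dist_real_def)
    show "\<exists>i<m. \<mu> i ?rb c < h i ?rb \<or> h i c * ?N c < h i ?rb"
    proof (rule ccontr)
      assume "\<not> ?thesis"
      then have "\<And>i. i < m \<Longrightarrow> h i ?rb \<le> \<mu> i ?rb c \<and> h i ?rb \<le> h i c * ?N c"
        by (meson not_le)
      then have "G (?rb, c) \<le> 0" unfolding G_def by (intro sum_nonpos) auto
      with \<open>0 < G (?rb, c)\<close> show False by simp
    qed
  qed
qed


(* If the centre were a peak, the cell could be pushed down to the roots away from the centre.  This
   homotopy, over the cell shrunk by the factor r, is a map of the (m+1)-cube that keeps all pairs of
   opposite faces apart. *)
lemma tree_product_no_peak:
  assumes T: "\<And>i. i < m \<Longrightarrow> tree_structure (top_of_set (sym_cube m)) (h i) (\<mu> i)"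
    and pos: "\<And>i b c. i < m \<Longrightarrow> b \<in> sym_cube m \<Longrightarrow> c \<in> sym_cube m \<Longrightarrow> 0 \<le> \<mu> i b c"
    and inj: "\<And>b c. b \<in> sym_cube m \<Longrightarrow> c \<in> sym_cube m \<Longrightarrow>
      (\<And>i. i < m \<Longrightarrow> h i b \<le> \<mu> i b c \<and> h i c \<le> \<mu> i b c) \<Longrightarrow> b = c"
    and "m > 0"
  shows "\<exists>b\<in>sym_cube m. b \<noteq> (\<lambda>_. 0) \<and> (\<forall>i<m. h i (\<lambda>_. 0) \<le> \<mu> i (\<lambda>_. 0) b)"
proof (rule ccontr)
  assume "\<not> ?thesis"
  then have peak: "\<exists>i<m. \<mu> i (\<lambda>_. 0) b < h i (\<lambda>_. 0)" if "b \<in> sym_cube m" "b \<noteq> (\<lambda>_. 0)" for b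
    using that by (meson not_le)
  let ?K = "sym_cube m" and ?Y = "top_of_set (unit_cube (Suc m))"
  have hpos: "0 \<le> h i b" if "i < m" "b \<in> ?K" for i b
    using pos[OF that(1) that(2) that(2)] tree_refl[OF T[OF that(1)], of b] that(2) by simp
  obtain r where r: "0 < r" "r < 1" and apart: "\<And>b c. b \<in> ?K \<Longrightarrow> c \<in> ?K \<Longrightarrow>
      \<exists>i<m. \<mu> i (\<lambda>i. r * b i) c < h i (\<lambda>i. r * b i) \<or>
        h i c * (1 - (\<Prod>i<m. 1 - (c i)\<^sup>2)) < h i (\<lambda>i. r * b i)"
    using tree_product_inner_radius[OF T pos \<open>m > 0\<close> peak] by blast
  \<comment> \<open>The coordinate \<open>y m\<close> is the time of the homotopy and the others run
    through the cell. At time 0 the cell is shrunk by r and not pushed; at time 1 it has full size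
    and its centre is at height 0. Boundary points are never pushed.\<close>
  define B where "B y = (\<lambda>i. if i < m then 2 * y i - 1 else (0::real))" for y :: "nat \<Rightarrow> real"
  define v where "v y = (\<lambda>i. (r + y m * (1 - r)) * B y i)" for y
  define c where "c y = 1 - y m * (\<Prod>i<m. 1 - (B y i)\<^sup>2)" for y
  have ym: "0 \<le> y m" "y m \<le> 1" if "y \<in> unit_cube (Suc m)" for y
    using that by (auto simp: unit_cube_def)
  have BK: "B y \<in> ?K" if "y \<in> unit_cube (Suc m)" for y
    using that by (auto simp: B_def unit_cube_def sym_cube_def abs_le_iff less_Suc_eq)
  have radius: "0 < r + y m * (1 - r)" "r + y m * (1 - r) \<le> 1" if "y \<in> unit_cube (Suc m)" for y
  proof -
    have "0 \<le> y m * (1 - r)" "y m * (1 - r) \<le> 1 - r"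
      using r ym[OF that] by (auto intro: mult_left_le_one_le)
    then show "0 < r + y m * (1 - r)" "r + y m * (1 - r) \<le> 1" using r(1) by simp_all
  qed
  have vK: "v y \<in> ?K" if "y \<in> unit_cube (Suc m)" for y
    unfolding v_def using sym_cube_scale[OF BK[OF that]] radius[OF that] by simp
  have contB: "continuous_on S (\<lambda>y. B y i)" for S i
    unfolding B_def
    by (cases "i < m") (auto intro!: continuous_intros continuous_on_subset[OF continuous_on_product_coordinates])
  have conty: "continuous_on S (\<lambda>y::nat\<Rightarrow>real. y i)" for S i
    by (rule continuous_on_subset[OF continuous_on_product_coordinates]) simp
  have cv: "continuous_map ?Y (top_of_set ?K) v"
  proof -
    have "continuous_on (unit_cube (Suc m)) v"
      unfolding v_def by (intro continuous_on_coordinatewise_then_product continuous_intros contB conty)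
    then show ?thesis using vK by (auto simp: continuous_map_in_subtopology)
  qed
  have cc: "continuous_map ?Y euclideanreal c"
    unfolding c_def continuous_map_iff_continuous by (intro continuous_intros contB conty)
  have c01: "0 \<le> c y \<and> c y \<le> 1" if "y \<in> unit_cube (Suc m)" for y
    using face_product_bounds[OF BK[OF that]] ym[OF that] by (auto simp: c_def intro: mult_le_one)
  have T': "tree_structure ?Y (\<lambda>y. h i (v y) * c y)
      (\<lambda>y z. min (min (h i (v y) * c y) (h i (v z) * c z)) (\<mu> i (v y) (v z)))" if "i < m" for i
    using tree_pullback_scaled[OF T[OF that] cv cc] c01 hpos[OF that] by simp
  obtain k y z where k: "k \<le> m" and yz: "y \<in> unit_cube (Suc m)" "z \<in> unit_cube (Suc m)"
    and yk: "y k = 0" and zk: "z k = 1"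
    and eq: "\<And>i. i < m \<Longrightarrow> h i (v y) * c y \<le> min (min (h i (v y) * c y) (h i (v z) * c z)) (\<mu> i (v y) (v z)) \<and>
       h i (v z) * c z \<le> min (min (h i (v y) * c y) (h i (v z) * c z)) (\<mu> i (v y) (v z))"
    by (rule tree_lebesgue[where m = m, OF T']) blast+
  show False
  proof (cases "k = m")
    case True
    have cy: "c y = 1" and cz: "c z = 1 - (\<Prod>i<m. 1 - (B z i)\<^sup>2)" using True yk zk by (simp_all add: c_def)
    have vy: "v y = (\<lambda>i. r * B y i)" and vz: "v z = B z" using True yk zk by (simp_all add: v_def)
    show False
      using apart[OF BK[OF yz(1)] BK[OF yz(2)]] eq unfolding cy cz vy vz by fastforce
  next
    case False
    then have km: "k < m" using k by simp
    \<comment> \<open>On these two side faces nothing is pushed, so injectivity of the cell applies,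
      although coordinate k of \<open>v\<close> has opposite signs there.\<close>
    have "B y k = -1" "B z k = 1" using km yk zk by (simp_all add: B_def)
    then have z0: "(\<Prod>i<m. 1 - (B y i)\<^sup>2) = 0" "(\<Prod>i<m. 1 - (B z i)\<^sup>2) = 0"
      using km by (auto intro!: prod_zero bexI[of _ k])
    then have c1: "c y = 1" "c z = 1" by (simp_all add: c_def)
    have "v y = v z"
      by (rule inj[OF vK[OF yz(1)] vK[OF yz(2)]]) (use eq c1 in simp)
    then have "v y k = v z k" by simp
    then show False
      using \<open>B y k = -1\<close> \<open>B z k = 1\<close> radius(1)[OF yz(1)] radius(1)[OF yz(2)] by (simp add: v_def)
  qed
qed

section \<open>Merge trees\<close>

definition merge_level :: "'a topology \<Rightarrow> ('a \<Rightarrow> real) \<Rightarrow> 'a \<Rightarrow> 'a \<Rightarrow> real" where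
  "merge_level X h x y = Sup {t. \<exists>C. connectedin X C \<and> x \<in> C \<and> y \<in> C \<and> (\<forall>z\<in>C. t \<le> h z)}"

lemma merge_level_ge:
  assumes "connectedin X C" "x \<in> C" "y \<in> C" "\<And>z. z \<in> C \<Longrightarrow> t \<le> h z"
  shows "t \<le> merge_level X h x y"
  unfolding merge_level_def using assms by (intro cSup_upper bdd_aboveI[of _ "h x"]) auto

context
  fixes X :: "'a topology" and h :: "'a \<Rightarrow> real" and b :: real
  assumes X: "connected_space X" and bdd: "\<And>x. x \<in> topspace X \<Longrightarrow> b \<le> h x"
begin

lemma merge_level_bound: "x \<in> topspace X \<Longrightarrow> y \<in> topspace X \<Longrightarrow> b \<le> merge_level X h x y"
  using X bdd by (intro merge_level_ge[of X "topspace X"]) (auto simp: connectedin_topspace)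

lemma merge_level_nonempty:
  assumes "x \<in> topspace X" "y \<in> topspace X"
  shows "b \<in> {t. \<exists>C. connectedin X C \<and> x \<in> C \<and> y \<in> C \<and> (\<forall>z\<in>C. t \<le> h z)}"
  using X bdd assms by (auto intro!: exI[of _ "topspace X"] simp: connectedin_topspace)

text \<open>Joining sets are obtained strictly below the supremum and not at it, so the later
  estimates pass through \<open>dense_le\<close>.\<close>

lemma less_merge_level:
  assumes "x \<in> topspace X" "y \<in> topspace X" "t < merge_level X h x y"
  obtains C where "connectedin X C" "x \<in> C" "y \<in> C" "\<And>z. z \<in> C \<Longrightarrow> t \<le> h z"
proof -
  obtain u C where "t < u" "connectedin X C" "x \<in> C" "y \<in> C" "\<forall>z\<in>C. u \<le> h z"
    using less_cSupD[OF _ assms(3)[unfolded merge_level_def]] merge_level_nonempty[OF assms(1,2)] by blast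
  then show thesis by (intro that[of C]) auto
qed

lemma merge_level_le:
  assumes "x \<in> topspace X" "y \<in> topspace X"
  shows "merge_level X h x y \<le> h x"
  unfolding merge_level_def using merge_level_nonempty[OF assms] by (intro cSup_least) auto

text \<open>Sets joining x to y and y to z above a level have a connected union, which is the
  ultrametric inequality. Connected neighbourhoods on which h hardly drops below \<open>h x\<close>
  give the neighbourhood clause.\<close>

lemma tree_structure_merge_level:
  assumes "locally_connected_space X" "continuous_map X euclideanreal h"
  shows "tree_structure X h (merge_level X h)"
  unfolding tree_structure_def
proof (intro conjI ballI allI impI)
  fix x y z assume t: "x \<in> topspace X" "y \<in> topspace X" "z \<in> topspace X"
  show "min (merge_level X h x y) (merge_level X h y z) \<le> merge_level X h x z"
  proof (rule dense_le)
    fix t0 assume "t0 < min (merge_level X h x y) (merge_level X h y z)"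
    then have l: "t0 < merge_level X h x y" "t0 < merge_level X h y z" by simp_all
    obtain C where C: "connectedin X C" "x \<in> C" "y \<in> C" "\<And>z. z \<in> C \<Longrightarrow> t0 \<le> h z"
      using less_merge_level[OF t(1,2) l(1)] by blast
    obtain D where D: "connectedin X D" "y \<in> D" "z \<in> D" "\<And>z. z \<in> D \<Longrightarrow> t0 \<le> h z"
      using less_merge_level[OF t(2,3) l(2)] by blast
    show "t0 \<le> merge_level X h x z"
      using C D by (intro merge_level_ge[of X "C \<union> D"] connectedin_Un) auto
  qed
next
  fix x and \<epsilon> :: real assume x: "x \<in> topspace X" and "0 < \<epsilon>"
  define V where "V = {z \<in> topspace X. h z \<in> {h x - \<epsilon>/2<..}}"
  have "openin X V" unfolding V_def by (rule openin_continuous_map_preimage[OF assms(2)]) auto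
  moreover have "x \<in> V" using x \<open>0 < \<epsilon>\<close> by (simp add: V_def)
  ultimately obtain U where U: "openin X U" "connectedin X U" "x \<in> U" "U \<subseteq> V"
    using assms(1) unfolding locally_connected_space by metis
  have "h x - \<epsilon>/2 \<le> merge_level X h z w" if "z \<in> U" "w \<in> U" for z w
    using that U by (intro merge_level_ge[of X U]) (auto simp: V_def)
  then show "\<exists>U. openin X U \<and> x \<in> U \<and> (\<forall>z\<in>U. \<forall>w\<in>U. h x - \<epsilon> < merge_level X h z w)"
    using U \<open>0 < \<epsilon>\<close> by (intro exI[of _ U]) fastforce
next
  show "merge_level X h x y = merge_level X h y x" for x y
    unfolding merge_level_def by (rule arg_cong[of _ _ Sup]) blast
qed (use assms merge_level_le in auto)

end

text \<open>The preimage of a small ball of the curve may have components on both sides of a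
  separator. Keeping only the component of a lets a bump vanish on a whole side in
  \<open>separating_height\<close>.\<close>

definition bump :: "'a topology \<Rightarrow> ('a \<Rightarrow> real) \<Rightarrow> 'a \<Rightarrow> 'a \<Rightarrow> real" where
  "bump X p a z =
     (if z \<in> connected_component_of_set (subtopology X {z \<in> topspace X. 0 < p z}) a then p z else 0)"

lemma bump_nonneg: "0 \<le> bump X p a z"
  unfolding bump_def using connected_component_in_topspace[of "subtopology X {z \<in> topspace X. 0 < p z}" a z]
  by auto

text \<open>By local connectedness the components of the set where p is positive are open, so the
  bump is locally p or 0 there. Elsewhere p is at most 0, and nearby values are squeezed between 0
  and the positive part of p.\<close>

lemma continuous_map_bump:
  assumes X: "locally_connected_space X" and p: "continuous_map X euclideanreal p"
  shows "continuous_map X euclideanreal (bump X p a)"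
proof (rule continuous_map_realI)
  fix x and \<epsilon> :: real assume x: "x \<in> topspace X" and "0 < \<epsilon>"
  let ?V = "{z \<in> topspace X. 0 < p z}"
  let ?U = "connected_component_of_set (subtopology X ?V)"
  have V: "openin X ?V"
    using openin_continuous_map_preimage[OF p, of "{0<..}"] by simp
  have U: "openin X (?U c)" for c
    using openin_connected_component_of_locally_connected_space[OF locally_connected_space_open_subset[OF X V]] V
    by (simp add: openin_open_subtopology)
  have sub: "?U c \<subseteq> ?V" for c
    using connected_component_of_subset_topspace[of "subtopology X ?V" c] by auto
  show "\<exists>U. openin X U \<and> x \<in> U \<and> (\<forall>y\<in>U. dist (bump X p a y) (bump X p a x) < \<epsilon>)"
  proof (cases "x \<in> ?U a")
    case True
    define W where "W = ?U a \<inter> {z \<in> topspace X. p z \<in> ball (p x) \<epsilon>}"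
    have "openin X W" unfolding W_def
      by (intro openin_Int U openin_continuous_map_preimage[OF p]) auto
    moreover have "x \<in> W" using True x \<open>0 < \<epsilon>\<close> by (simp add: W_def)
    moreover have "dist (bump X p a y) (bump X p a x) < \<epsilon>" if "y \<in> W" for y
      using that True by (auto simp: W_def bump_def dist_commute)
    ultimately show ?thesis by blast
  next
    case False
    show ?thesis
    proof (cases "0 < p x")
      case True
      have "x \<in> ?U x" using True x by (simp add: connected_component_of_refl)
      moreover have "?U x \<inter> ?U a = {}"
        using False connected_component_of_disjoint[of "subtopology X ?V" x a]
          connected_component_of_sym[of "subtopology X ?V" x a] by (simp add: disjnt_def)
      then have "dist (bump X p a y) (bump X p a x) < \<epsilon>" if "y \<in> ?U x" for y
        using that False \<open>0 < \<epsilon>\<close> by (auto simp: bump_def)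
      ultimately show ?thesis using U by blast
    next
      case f: False
      define W where "W = {z \<in> topspace X. p z \<in> {..<\<epsilon>}}"
      have "openin X W" unfolding W_def by (intro openin_continuous_map_preimage[OF p]) auto
      moreover have "x \<in> W" using f x \<open>0 < \<epsilon>\<close> by (simp add: W_def)
      moreover have "dist (bump X p a y) (bump X p a x) < \<epsilon>" if "y \<in> W" for y
        using that False \<open>0 < \<epsilon>\<close> bump_nonneg[of X p a y] by (auto simp: W_def bump_def dist_real_def)
      ultimately show ?thesis by blast
    qed
  qed
qed

text \<open>A connected set on which p is a positive constant lies in a single component. This will
  be applied to separators, which the map to the curve sends to one point.\<close>

lemma bump_constant:
  assumes E: "connectedin X E" and p: "\<And>e e'. e \<in> E \<Longrightarrow> e' \<in> E \<Longrightarrow> p e = p e'" and ee: "e \<in> E" "e' \<in> E"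
  shows "bump X p a e = bump X p a e'"
proof (cases "0 < p e")
  case True
  let ?V = "{z \<in> topspace X. 0 < p z}"
  have "0 < p c" if "c \<in> E" for c using True p[OF ee(1) that] by simp
  then have "E \<subseteq> ?V" using connectedin_subset_topspace[OF E] by blast
  then have "connectedin (subtopology X ?V) E" using E by (simp add: connectedin_subtopology)
  then have "connected_component_of (subtopology X ?V) e e'"
    using ee unfolding connected_component_of_def by blast
  then have "connected_component_of (subtopology X ?V) a e \<longleftrightarrow> connected_component_of (subtopology X ?V) a e'"
    by (meson connected_component_of_sym connected_component_of_trans)
  then show ?thesis using p[OF ee] by (simp add: bump_def)
next
  case False
  then have "bump X p a c = 0" if "c \<in> E" for c
    using p[OF that ee(1)] connected_component_in_topspace[of "subtopology X {z \<in> topspace X. 0 < p z}" a c]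
    by (auto simp: bump_def)
  then show ?thesis using ee by simp
qed

(* Distance from 0 serves as a continuous, strictly monotone sum of countably many heights. *)
lemma dist_fun_zero_mono:
  fixes F G :: "nat \<Rightarrow> real"
  assumes "\<And>n. 0 \<le> F n \<and> F n \<le> G n \<and> G n \<le> 1"
  shows "dist F (\<lambda>_. 0) \<le> dist G (\<lambda>_. 0)"
    and "dist G (\<lambda>_. 0) \<le> dist F (\<lambda>_. 0) \<Longrightarrow> F n = G n"
proof -
  have sm: "summable (\<lambda>n. (1/2) ^ n * min (dist (H (from_nat n)) 0) 1)" for H :: "nat \<Rightarrow> real"
    by (rule summable_comparison_test'[of "\<lambda>n. (1/2)^n"]) (auto simp: summable_geometric_iff)
  have d: "dist H (\<lambda>_. 0) = (\<Sum>n. (1/2) ^ n * min (dist (H (from_nat n)) 0) 1)" for H :: "nat \<Rightarrow> real"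
    by (simp add: dist_fun_def)
  have le: "(1/2) ^ n * min (dist (F (from_nat n)) 0) 1 \<le> (1/2) ^ n * min (dist (G (from_nat n)) 0) 1" for n
    using assms[of "from_nat n"] by (intro mult_left_mono) auto
  show "dist F (\<lambda>_. 0) \<le> dist G (\<lambda>_. 0)"
    unfolding d by (intro suminf_le le sm)
  show "F n = G n" if "dist G (\<lambda>_. 0) \<le> dist F (\<lambda>_. 0)"
  proof -
    let ?t = "\<lambda>n. (1/2) ^ n * min (dist (G (from_nat n)) 0) 1 - (1/2) ^ n * min (dist (F (from_nat n)) 0) 1"
    have s: "summable ?t" by (intro summable_diff sm)
    have t0: "0 \<le> ?t k" for k using le[of k] by simp
    have "suminf ?t = dist G (\<lambda>_. 0) - dist F (\<lambda>_. 0)"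
      unfolding d by (rule suminf_diff[OF sm sm, symmetric])
    then have "suminf ?t = 0" using that suminf_nonneg[OF s t0] by linarith
    then have "\<forall>k. ?t k = 0" using suminf_eq_zero_iff[OF s t0] by blast
    then have "?t (to_nat n) = 0" ..
    moreover have "dist (G n) 0 = G n" "dist (F n) 0 = F n" using assms[of n] by (auto simp: dist_real_def)
    ultimately have "(1/2::real) ^ to_nat n * min (G n) 1 = (1/2) ^ to_nat n * min (F n) 1"
      by (simp only: from_nat_to_nat right_minus_eq)
    then have "min (G n) 1 = min (F n) 1" by (simp only: mult_cancel_left) simp
    then show ?thesis using assms[of n] by linarith
  qed
qed

section \<open>Heights that separate the points of a curve\<close>

lemma (in Metric_space) continuous_map_dist_point:
  assumes \<phi>: "continuous_map X mtopology \<phi>" and a: "a \<in> M"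
  shows "continuous_map X euclideanreal (\<lambda>z. d (\<phi> z) a)"
proof (rule continuous_map_realI)
  fix x and \<epsilon> :: real assume x: "x \<in> topspace X" and "0 < \<epsilon>"
  have in_M: "\<phi> z \<in> M" if "z \<in> topspace X" for z
    using \<phi> that by (auto simp: continuous_map_def)
  define W where "W = {w \<in> topspace X. \<phi> w \<in> mball (\<phi> x) \<epsilon>}"
  have "openin X W" unfolding W_def by (intro openin_continuous_map_preimage[OF \<phi>]) auto
  moreover have "x \<in> W" using x in_M \<open>0 < \<epsilon>\<close> by (simp add: W_def)
  moreover have "dist (d (\<phi> w) a) (d (\<phi> x) a) < \<epsilon>" if "w \<in> W" for w
  proof -
    have w: "\<phi> w \<in> M" "d (\<phi> x) (\<phi> w) < \<epsilon>" using that in_M by (auto simp: W_def)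
    then show ?thesis
      using triangle[of "\<phi> w" "\<phi> x" a] triangle[of "\<phi> x" "\<phi> w" a] in_M[OF x] a commute[of "\<phi> x" "\<phi> w"]
      by (simp add: dist_real_def abs_less_iff)
  qed
  ultimately show "\<exists>U. openin X U \<and> x \<in> U \<and> (\<forall>y\<in>U. dist (d (\<phi> y) a) (d (\<phi> x) a) < \<epsilon>)"
    by blast
qed

text \<open>Finite nets at every scale leave only countably many bumps to be summed. The connected
  set C places x in the component on which the bump at a is kept.\<close>

lemma (in Metric_space) small_connected_net:
  assumes "compact_space X" "locally_connected_space X" and \<phi>: "continuous_map X mtopology \<phi>" and "0 < \<epsilon>"
  shows "\<exists>F. finite F \<and> F \<subseteq> topspace X \<and> (\<forall>x\<in>topspace X. \<exists>a\<in>F. \<exists>C. connectedin X C \<and> a \<in> C \<and> x \<in> C \<and>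
    (\<forall>z\<in>C. d (\<phi> z) (\<phi> a) < \<epsilon>))"
proof -
  have in_M: "\<phi> z \<in> M" if "z \<in> topspace X" for z
    using \<phi> that by (auto simp: continuous_map_def)
  have "\<exists>C. openin X C \<and> connectedin X C \<and> a \<in> C \<and> (\<forall>z\<in>C. d (\<phi> z) (\<phi> a) < \<epsilon>)" if a: "a \<in> topspace X" for a
  proof -
    define W where "W = {w \<in> topspace X. \<phi> w \<in> mball (\<phi> a) \<epsilon>}"
    have "openin X W" unfolding W_def by (intro openin_continuous_map_preimage[OF \<phi>]) auto
    moreover have "a \<in> W" using a in_M \<open>0 < \<epsilon>\<close> by (simp add: W_def)
    ultimately obtain C where "openin X C" "connectedin X C" "a \<in> C" "C \<subseteq> W"
      using assms(2) unfolding locally_connected_space by metis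
    then show ?thesis by (intro exI[of _ C]) (auto simp: W_def commute)
  qed
  then obtain C where C: "\<And>a. a \<in> topspace X \<Longrightarrow> openin X (C a) \<and> connectedin X (C a) \<and> a \<in> C a \<and>
      (\<forall>z\<in>C a. d (\<phi> z) (\<phi> a) < \<epsilon>)"
    by metis
  have "\<exists>\<F>. finite \<F> \<and> \<F> \<subseteq> C ` topspace X \<and> topspace X \<subseteq> \<Union>\<F>"
    using assms(1) C unfolding compact_space_alt by (auto dest!: spec[of _ "C ` topspace X"])
  then obtain \<F> where \<F>: "finite \<F>" "\<F> \<subseteq> C ` topspace X" "topspace X \<subseteq> \<Union>\<F>" by blast
  then obtain F where F: "F \<subseteq> topspace X" "finite F" "\<F> = C ` F"
    by (meson finite_subset_image)
  show ?thesis
  proof (intro exI[of _ F] conjI ballI F)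
    fix x assume "x \<in> topspace X"
    then obtain a where "a \<in> F" "x \<in> C a" using \<F>(3) F(3) by auto
    then show "\<exists>a\<in>F. \<exists>C. connectedin X C \<and> a \<in> C \<and> x \<in> C \<and> (\<forall>z\<in>C. d (\<phi> z) (\<phi> a) < \<epsilon>)"
      using C F(1) by blast
  qed
qed

(* The height sums, over countably many bumps g, the least possible maximum of g on a connected set
   from \<rho> to y, which is minus the merge_level level of -g.  It is constant on a separator, does not
   decrease beyond it, and increases strictly because a bump near y vanishes on the near side. *)
lemma separating_height:
  assumes "compact_space X" and conn: "connected_space X" and lc: "locally_connected_space X"
    and \<phi>: "continuous_map X Y \<phi>" and "metrizable_space Y" and \<rho>: "\<rho> \<in> topspace X"
    and sep: "\<And>x y. x \<in> topspace X \<Longrightarrow> y \<in> topspace X \<Longrightarrow> \<phi> x \<noteq> \<phi> y \<Longrightarrow>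
      \<exists>B c. openin X B \<and> connectedin X B \<and> connectedin X (topspace X - B) \<and> y \<in> B \<and> x \<notin> X closure_of B \<and>
        connectedin X (X frontier_of B) \<and> (\<forall>e\<in>X frontier_of B. \<phi> e = c) \<and> c \<noteq> \<phi> x \<and> c \<noteq> \<phi> y"
  obtains h where "continuous_map X euclideanreal h" "\<And>x. x \<in> topspace X \<Longrightarrow> 0 \<le> h x" "h \<rho> = 0"
    "\<And>x y. x \<in> topspace X \<Longrightarrow> y \<in> topspace X \<Longrightarrow> h x \<le> merge_level X h x y \<Longrightarrow> h y \<le> merge_level X h x y \<Longrightarrow> \<phi> x = \<phi> y"
proof -
  obtain N d where "Metric_space N d" and Y: "Y = Metric_space.mtopology N d"
    using \<open>metrizable_space Y\<close> unfolding metrizable_space_def by blast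
  then interpret Metric_space N d by simp
  have \<phi>: "continuous_map X mtopology \<phi>" using \<phi> Y by simp
  have in_M: "\<phi> z \<in> N" if "z \<in> topspace X" for z
    using \<phi> that by (auto simp: continuous_map_def)
  define p where "p k a z = 1 / (real k + 1) - d (\<phi> z) (\<phi> a)" for k :: nat and a z
  have cont_p: "continuous_map X euclideanreal (p k a)" if "a \<in> topspace X" for k a
    unfolding p_def by (intro continuous_map_diff continuous_map_dist_point[OF \<phi> in_M[OF that]]) auto
  have "\<forall>k::nat. \<exists>F. finite F \<and> F \<subseteq> topspace X \<and> (\<forall>x\<in>topspace X. \<exists>a\<in>F. \<exists>C. connectedin X C \<and> a \<in> C \<and> x \<in> C \<and>
      (\<forall>z\<in>C. d (\<phi> z) (\<phi> a) < 1 / (real k + 1)))"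
  proof
    fix k :: nat
    have "0 < 1 / (real k + 1)" by simp
    from small_connected_net[OF assms(1) lc \<phi> this]
    show "\<exists>F. finite F \<and> F \<subseteq> topspace X \<and> (\<forall>x\<in>topspace X. \<exists>a\<in>F. \<exists>C. connectedin X C \<and> a \<in> C \<and> x \<in> C \<and>
      (\<forall>z\<in>C. d (\<phi> z) (\<phi> a) < 1 / (real k + 1)))" .
  qed
  from choice[OF this] obtain F where "\<forall>k::nat. finite (F k) \<and> F k \<subseteq> topspace X \<and> (\<forall>x\<in>topspace X. \<exists>a\<in>F k. \<exists>C. connectedin X C \<and> a \<in> C \<and> x \<in> C \<and>
      (\<forall>z\<in>C. d (\<phi> z) (\<phi> a) < 1 / (real k + 1)))" ..
  then have F: "\<And>k. finite (F k)" "\<And>k. F k \<subseteq> topspace X"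
    "\<And>k x. x \<in> topspace X \<Longrightarrow> \<exists>a\<in>F k. \<exists>C. connectedin X C \<and> a \<in> C \<and> x \<in> C \<and>
      (\<forall>z\<in>C. d (\<phi> z) (\<phi> a) < 1 / (real k + 1))" by blast+
  define D where "D = (SIGMA k:UNIV. F k)"
  have D: "countable D" "D \<noteq> {}"
  proof -
    show "countable D" unfolding D_def using F(1) by (intro countable_SIGMA) (auto intro: countable_finite)
    obtain a where "a \<in> F 0" using F(3)[OF \<rho>] by blast
    then show "D \<noteq> {}" by (auto simp: D_def)
  qed
  define q where "q = from_nat_into D"
  have q: "snd (q n) \<in> topspace X" for n
    using from_nat_into[OF D(2), of n] F(2)[of "fst (q n)"] by (auto simp: q_def D_def)
  define g where "g n = bump X (p (fst (q n)) (snd (q n))) (snd (q n))" for n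
  have cont_g: "continuous_map X euclideanreal (\<lambda>z. - g n z)" for n
    unfolding g_def by (intro continuous_map_minus continuous_map_bump[OF lc] cont_p q)
  have g0: "0 \<le> g n z" for n z unfolding g_def by (rule bump_nonneg)
  have g1: "g n z \<le> 1" for n z
  proof -
    have "1 / (real (fst (q n)) + 1) \<le> 1" by simp
    then have "p (fst (q n)) (snd (q n)) z \<le> 1" unfolding p_def using nonneg[of "\<phi> z" "\<phi> (snd (q n))"] by linarith
    then show ?thesis by (simp add: g_def bump_def)
  qed
  have bnd: "-1 \<le> - g n z" for n z using g1[of n z] by simp
  define \<mu> where "\<mu> n = merge_level X (\<lambda>z. - g n z)" for n
  have T: "tree_structure X (\<lambda>z. - g n z) (\<mu> n)" for n
    unfolding \<mu>_def using tree_structure_merge_level[OF conn bnd lc cont_g] .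
  have \<mu>_le: "\<mu> n \<rho> y \<le> - g n \<rho>" "\<mu> n \<rho> y \<le> - g n y" if "y \<in> topspace X" for n y
    using tree_le1[OF T \<rho> that, of n] tree_le2[OF T \<rho> that, of n] by auto
  have \<mu>_ge: "-1 \<le> \<mu> n \<rho> y" if "y \<in> topspace X" for n y
    unfolding \<mu>_def using merge_level_bound[OF conn bnd \<rho> that] .
  \<comment> \<open>Subtracting \<open>g n \<rho>\<close>, the least possible maximum, gives
    \<open>\<rho>\<close> the height 0. The value 0 off the space makes \<open>H01\<close> hold for
    all y.\<close>
  define H where "H y = (\<lambda>n. if y \<in> topspace X then - \<mu> n \<rho> y - g n \<rho> else 0)" for y
  have H01: "0 \<le> H y n \<and> H y n \<le> 1" for y n
    using \<mu>_le(1)[of y n] \<mu>_ge[of y n] g0[of n \<rho>] by (auto simp: H_def)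
  have cont_H: "continuous_map X euclidean H"
  proof -
    have "continuous_map X euclideanreal (\<lambda>y. H y n)" for n
    proof (rule continuous_map_eq)
      have "continuous_map X (prod_topology X X) (\<lambda>y. (\<rho>, y))"
        using \<rho> by (simp add: continuous_map_pairedI)
      from continuous_map_compose[OF this tree_continuous[OF T[of n]]]
      show "continuous_map X euclideanreal (\<lambda>y. - \<mu> n \<rho> y - g n \<rho>)"
        by (intro continuous_map_diff continuous_map_minus) (auto simp: o_def)
    qed (simp add: H_def)
    then show ?thesis by (simp add: continuous_map_componentwise_UNIV flip: euclidean_product_topology)
  qed
  define h where "h y = dist (H y) (\<lambda>_. 0)" for y
  have cont_h: "continuous_map X euclideanreal h"
  proof -
    have "continuous_map euclidean euclideanreal (\<lambda>F::nat\<Rightarrow>real. dist F (\<lambda>_. 0))"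
      by (simp add: continuous_map_iff_continuous2 continuous_intros)
    from continuous_map_compose[OF cont_H this] show ?thesis by (simp add: o_def h_def[abs_def])
  qed
  have key: "\<phi> x = \<phi> y" if xy: "x \<in> topspace X" "y \<in> topspace X"
    "h x \<le> merge_level X h x y" "h y \<le> merge_level X h x y" for x y
  proof (rule ccontr)
    assume "\<phi> x \<noteq> \<phi> y"
    have h0: "0 \<le> h z" for z by (simp add: h_def)
    obtain B c where B: "openin X B" "connectedin X B" "connectedin X (topspace X - B)" "y \<in> B"
        "x \<notin> X closure_of B" and E: "connectedin X (X frontier_of B)"
        "\<And>e. e \<in> X frontier_of B \<Longrightarrow> \<phi> e = c" and c: "c \<noteq> \<phi> x" "c \<noteq> \<phi> y"
      using sep[OF xy(1,2) \<open>\<phi> x \<noteq> \<phi> y\<close>] by metis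
    let ?E = "X frontier_of B"
    have fr: "?E = X closure_of B - B"
      using B(1) by (simp add: frontier_of_def interior_of_openin)
    have Et: "?E \<subseteq> topspace X" by (rule frontier_of_subset_topspace)
    have Bcl: "B \<subseteq> X closure_of B" using B(1) by (simp add: closure_of_subset openin_subset)
    have meets: "Q \<inter> ?E \<noteq> {}" if "connectedin X Q" "a \<in> Q" "a \<in> B" "b \<in> Q" "b \<notin> B" for Q a b
      using connectedin_Int_frontier_of[OF that(1), of B] that by blast
    \<comment> \<open>Of x and y, w is the one that the separator cuts off from
      \<open>\<rho>\<close>, and S is the side of \<open>\<rho>\<close> together with the separator.
      If \<open>\<rho>\<close> is in B, then S is the closure of B, and x avoids it because x is
      outside that closure.\<close>
    obtain w S where w: "w = x \<or> w = y" and S: "connectedin X S" "\<rho> \<in> S" "?E \<subseteq> S" "w \<notin> S"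
      and wE: "\<And>Q a. connectedin X Q \<Longrightarrow> w \<in> Q \<Longrightarrow> a \<in> Q \<Longrightarrow> a \<in> S \<Longrightarrow> Q \<inter> ?E \<noteq> {}"
    proof (cases "\<rho> \<in> B")
      case False
      show thesis
      proof (rule that[of y "topspace X - B"])
        show "?E \<subseteq> topspace X - B" using Et fr by blast
        show "Q \<inter> ?E \<noteq> {}" if "connectedin X Q" "y \<in> Q" "a \<in> Q" "a \<in> topspace X - B" for Q a
          using meets[OF that(1,2) B(4) that(3)] that(4) by blast
      qed (use B \<rho> False in auto)
    next
      case True
      show thesis
      proof (rule that[of x "X closure_of B"])
        show "connectedin X (X closure_of B)" using B(2) by (rule connectedin_closure_of)
        show "Q \<inter> ?E \<noteq> {}" if "connectedin X Q" "x \<in> Q" "a \<in> Q" "a \<in> X closure_of B" for Q a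
          using meets[OF that(1,3) _ that(2)] B(5) Bcl fr that by blast
      qed (use B True Bcl fr in auto)
    qed
    have wt: "w \<in> topspace X" using w xy by blast
    have wc: "\<phi> w \<noteq> c" using w c by auto
    obtain e where e: "e \<in> ?E"
      using wE[of "topspace X" \<rho>] conn S wt \<rho> by (auto simp: connectedin_topspace)
    have et: "e \<in> topspace X" using e Et by blast
    have p_const: "p k a e1 = p k a e2" if "e1 \<in> ?E" "e2 \<in> ?E" for k a e1 e2
      using E(2)[OF that(1)] E(2)[OF that(2)] by (simp add: p_def)
    have g_const: "g n e1 = g n e2" if "e1 \<in> ?E" "e2 \<in> ?E" for n e1 e2
      unfolding g_def by (rule bump_constant[OF E(1) p_const that])
    have \<mu>_const: "\<mu> n \<rho> e1 \<le> \<mu> n \<rho> e2" if ee: "e1 \<in> ?E" "e2 \<in> ?E" for n e1 e2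
    proof -
      have "- g n e1 \<le> \<mu> n e1 e2" unfolding \<mu>_def
        by (rule merge_level_ge[OF E(1) ee]) (simp add: g_const[OF ee(1)])
      then show ?thesis
        using tree_ultra[OF T \<rho>, of e1 e2 n] \<mu>_le(2)[of e1 n] ee Et by fastforce
    qed
    have H_const: "H e1 = H e2" if "e1 \<in> ?E" "e2 \<in> ?E" for e1 e2
      using \<mu>_const[OF that] \<mu>_const[OF that(2,1)] that Et by (auto simp: H_def fun_eq_iff intro: antisym)
    have "\<mu> n \<rho> w \<le> \<mu> n \<rho> e" for n
    proof (rule dense_le)
      fix t assume "t < \<mu> n \<rho> w"
      then obtain C where C: "connectedin X C" "\<rho> \<in> C" "w \<in> C" "\<And>z. z \<in> C \<Longrightarrow> t \<le> - g n z"
        unfolding \<mu>_def by (rule less_merge_level[OF conn bnd \<rho> wt]) blast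
      obtain e' where e': "e' \<in> C" "e' \<in> ?E" using wE[OF C(1,3,2) S(2)] by blast
      have "t \<le> \<mu> n \<rho> e'" unfolding \<mu>_def by (rule merge_level_ge[OF C(1,2) e'(1) C(4)])
      also have "\<dots> \<le> \<mu> n \<rho> e" by (rule \<mu>_const[OF e'(2) e])
      finally show "t \<le> \<mu> n \<rho> e" .
    qed
    then have "H e n \<le> H w n" for n using wt et by (simp add: H_def)
    then have Hle: "0 \<le> H e n \<and> H e n \<le> H w n \<and> H w n \<le> 1" for n
      using H01 by blast
    \<comment> \<open>A connected set from x to y meets the separator, where h has the constant
      value \<open>h e\<close>. So \<open>h w\<close> is at most \<open>h e\<close>, although every
      coordinate of \<open>H w\<close> is at least that of \<open>H e\<close>; hence all coordinates
      agree.\<close>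
    have "h w \<le> merge_level X h x y" using w xy by auto
    also have "merge_level X h x y \<le> h e"
    proof (rule dense_le)
      fix t assume "t < merge_level X h x y"
      then obtain C where C: "connectedin X C" "x \<in> C" "y \<in> C" "\<And>z. z \<in> C \<Longrightarrow> t \<le> h z"
        by (rule less_merge_level[OF conn h0 xy(1,2)]) blast
      have "x \<notin> B" using B(5) Bcl by blast
      then obtain e' where "e' \<in> C" "e' \<in> ?E" using meets[OF C(1,3) B(4) C(2)] by blast
      then show "t \<le> h e" using C(4)[of e'] H_const[of e' e] e by (simp add: h_def)
    qed
    finally have eq: "H e n = H w n" for n
      unfolding h_def using dist_fun_zero_mono(2)[of "H e" "H w", OF Hle] by blast
    have "d (\<phi> w) c > 0" using wc in_M[OF wt] in_M[OF et] E(2)[OF e] by (simp add: mdist_pos_less)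
    \<comment> \<open>Twice the radius is less than the distance from \<open>\<phi> w\<close> to c,
      so a ball of this radius that contains \<open>\<phi> w\<close> misses c. The component
      carrying the bump then misses the separator and, containing w, stays off S.\<close>
    then obtain k :: nat where k: "2 / (real k + 1) < d (\<phi> w) c"
    proof -
      obtain k :: nat where "2 / d (\<phi> w) c < real k" using reals_Archimedean2 by blast
      then have "2 < (real k + 1) * d (\<phi> w) c" using \<open>d (\<phi> w) c > 0\<close>
        by (simp add: divide_less_eq algebra_simps)
      then show thesis by (intro that[of k]) (simp add: divide_less_eq mult.commute)
    qed
    obtain a C where aC: "a \<in> F k" "connectedin X C" "a \<in> C" "w \<in> C"
      "\<And>z. z \<in> C \<Longrightarrow> d (\<phi> z) (\<phi> a) < 1 / (real k + 1)"
      using F(3)[OF wt, of k] by blast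
    have at: "a \<in> topspace X" using aC(1) F(2) by blast
    obtain n where n: "q n = (k, a)"
      using from_nat_into_surj[OF D(1), of "(k, a)"] aC(1) by (auto simp: q_def D_def)
    let ?V = "{z \<in> topspace X. 0 < p k a z}"
    have "C \<subseteq> ?V" using aC(5) connectedin_subset_topspace[OF aC(2)] by (auto simp: p_def)
    then have "connected_component_of (subtopology X ?V) a w"
      unfolding connected_component_of_def using aC by (auto simp: connectedin_subtopology)
    then have gw: "0 < g n w"
      using \<open>C \<subseteq> ?V\<close> aC(4) by (auto simp: g_def n bump_def)
    have gS: "g n z = 0" if zS: "z \<in> S" for z
    proof (rule ccontr)
      assume "g n z \<noteq> 0"
      then have z: "connected_component_of (subtopology X ?V) a z" by (auto simp: g_def n bump_def split: if_splits)
      let ?U = "connected_component_of_set (subtopology X ?V) a"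
      have U: "connectedin X ?U" "?U \<subseteq> ?V"
        using connectedin_connected_component_of[of "subtopology X ?V" a] by (auto simp: connectedin_subtopology)
      obtain e' where e': "e' \<in> ?U" "e' \<in> ?E"
        using wE[OF U(1), of z] \<open>connected_component_of (subtopology X ?V) a w\<close> z zS by auto
      then have "d c (\<phi> a) < 1 / (real k + 1)" using U(2) E(2)[OF e'(2)] by (auto simp: p_def)
      moreover have "d (\<phi> w) (\<phi> a) < 1 / (real k + 1)" using aC by blast
      moreover have "d (\<phi> w) c \<le> d (\<phi> w) (\<phi> a) + d (\<phi> a) c"
        using in_M[OF wt] in_M[OF at] in_M[OF et] E(2)[OF e] by (intro triangle) auto
      ultimately show False using k commute[of "\<phi> a" c] by simp
    qed
    have "0 \<le> \<mu> n \<rho> e" unfolding \<mu>_def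
      by (rule merge_level_ge[OF S(1,2)]) (use S e gS in auto)
    moreover have "\<mu> n \<rho> w < 0" using \<mu>_le(2)[OF wt, of n] gw by linarith
    ultimately show False using eq[of n] wt et by (simp add: H_def)
  qed
  show thesis
  proof (rule that[OF cont_h _ _ key])
    have "\<mu> n \<rho> \<rho> = - g n \<rho>" for n by (rule tree_refl[OF T \<rho>])
    then have "H \<rho> = (\<lambda>_. 0)" by (simp add: H_def fun_eq_iff)
    then show "h \<rho> = 0" by (simp add: h_def)
  qed (auto simp: h_def)
qed

section \<open>Separation in unicoherent spaces\<close>

definition unicoherent_space :: "'a topology \<Rightarrow> bool" where
  "unicoherent_space X \<longleftrightarrow>
     (\<forall>A B. closedin X A \<and> closedin X B \<and> connectedin X A \<and> connectedin X B \<and> A \<union> B = topspace X \<longrightarrow>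
        connectedin X (A \<inter> B))"

text \<open>Components of open sets are open here, so the components other than A fill the rest of V
  with open sets; this makes A closed relative to V.\<close>

lemma open_component:
  assumes lc: "locally_connected_space X" and V: "openin X V" and a: "a \<in> V"
  obtains A where "openin X A" "connectedin X A" "a \<in> A" "A \<subseteq> V" "X closure_of A \<inter> V \<subseteq> A"
    "\<And>C. connectedin X C \<Longrightarrow> C \<subseteq> V \<Longrightarrow> C \<inter> A \<noteq> {} \<Longrightarrow> C \<subseteq> A"
proof -
  let ?S = "subtopology X V"
  let ?C = "connected_component_of_set ?S"
  have Vt: "V \<subseteq> topspace X" using V by (rule openin_subset)
  have op: "openin X (?C x)" for x
    using openin_connected_component_of_locally_connected_space[OF locally_connected_space_open_subset[OF lc V]] V
    by (simp add: openin_open_subtopology)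
  have sub: "?C x \<subseteq> V" for x
    using connected_component_of_subset_topspace[of ?S x] by auto
  have max: "C \<subseteq> ?C a" if C': "connectedin X C" "C \<subseteq> V" "C \<inter> ?C a \<noteq> {}" for C
  proof -
    have C: "connectedin ?S C" using C' by (simp add: connectedin_subtopology)
    obtain z where z: "z \<in> C" "z \<in> ?C a" using C'(3) by blast
    then have "?C a = ?C z" using connected_component_of_equiv[of ?S a z] by simp
    then show ?thesis using connected_component_of_maximal[OF C z(1)] by simp
  qed
  have refl: "x \<in> ?C x" if "x \<in> V" for x
  proof -
    have "x \<in> topspace ?S" using that Vt by auto
    then show ?thesis using connected_component_of_refl[of ?S x] by (simp only: mem_Collect_eq)
  qed
  have cl: "X closure_of (?C a) \<inter> V \<subseteq> ?C a"
  proof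
    fix x assume x: "x \<in> X closure_of (?C a) \<inter> V"
    then have xV: "x \<in> V" and xcl: "x \<in> X closure_of (?C a)" by (rule IntD2, rule IntD1)
    obtain w where "w \<in> ?C a" "w \<in> ?C x"
      using conjunct2[OF xcl[unfolded in_closure_of], rule_format, OF conjI[OF refl[OF xV] op]]
      by (elim exE conjE)
    then have "?C x \<inter> ?C a \<noteq> {}" by blast
    moreover have "connectedin X (?C x)"
      using connectedin_connected_component_of[of ?S x] by (simp add: connectedin_subtopology)
    ultimately have "?C x \<subseteq> ?C a" by (intro max sub)
    then show "x \<in> ?C a" using refl[OF xV] by (rule subsetD)
  qed
  have "connectedin X (?C a)"
    using connectedin_connected_component_of[of ?S a] by (simp add: connectedin_subtopology)
  then show thesis by (rule that[OF op _ refl[OF a] sub cl max])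
qed

text \<open>As X is connected, the closure of every component of the complement of K meets K. So K
  together with such a closure is connected, and these sets, for the components other than B, cover
  the complement of B along with K.\<close>

lemma connectedin_complement_component:
  assumes conn: "connected_space X" and lc: "locally_connected_space X"
    and K: "closedin X K" "connectedin X K" "K \<noteq> {}"
    and B: "openin X B" "B \<subseteq> topspace X - K"
    and max: "\<And>C. connectedin X C \<Longrightarrow> C \<subseteq> topspace X - K \<Longrightarrow> C \<inter> B \<noteq> {} \<Longrightarrow> C \<subseteq> B"
  shows "connectedin X (topspace X - B)"
proof -
  let ?V = "topspace X - K"
  have V: "openin X ?V" using K(1) by (intro openin_diff openin_topspace)
  have Kt: "K \<subseteq> topspace X" using K(1) by (rule closedin_subset)
  have "\<exists>S. connectedin X S \<and> K \<subseteq> S \<and> x \<in> S \<and> S \<inter> B = {}" if x: "x \<in> topspace X - B" for x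
  proof (cases "x \<in> K")
    case True
    then show ?thesis using K B by blast
  next
    case False
    then have "x \<in> ?V" using x by blast
    then obtain A where A: "openin X A" "connectedin X A" "x \<in> A" "A \<subseteq> ?V"
      "X closure_of A \<inter> ?V \<subseteq> A" by (rule open_component[OF lc V]) blast
    have "A \<inter> B = {}" using max[OF A(2,4)] A(3) x by blast
    then have clB: "X closure_of A \<inter> B = {}"
      using B(1) by (simp add: openin_Int_closure_of_eq_empty Int_commute)
    have Acl: "A \<subseteq> X closure_of A" using A(1) by (simp add: closure_of_subset openin_subset)
    have "X frontier_of A \<noteq> {}"
    proof -
      have "topspace X \<inter> X frontier_of A \<noteq> {}"
        using conn A K(3) Kt by (intro connectedin_Int_frontier_of) (auto simp: connectedin_topspace dest: openin_subset)
      then show ?thesis by blast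
    qed
    then obtain f where "f \<in> X closure_of A" "f \<notin> A"
      using A(1) by (auto simp: frontier_of_def interior_of_openin)
    then have "f \<in> X closure_of A \<inter> K" using A(5) closure_of_subset_topspace[of X A] by blast
    then have "connectedin X (K \<union> X closure_of A)"
      using K(2) connectedin_closure_of[OF A(2)] by (intro connectedin_Un) auto
    then show ?thesis using clB A(3) Acl B by (intro exI[of _ "K \<union> X closure_of A"]) auto
  qed
  then obtain S where S: "\<And>x. x \<in> topspace X - B \<Longrightarrow> connectedin X (S x) \<and> K \<subseteq> S x \<and> x \<in> S x \<and> S x \<inter> B = {}"
    by metis
  have "topspace X - B = \<Union>(S ` (topspace X - B))"
  proof
    show "\<Union>(S ` (topspace X - B)) \<subseteq> topspace X - B"
      using S connectedin_subset_topspace by fastforce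
  qed (use S in blast)
  moreover have "connectedin X (\<Union>(S ` (topspace X - B)))"
    by (rule connectedin_Union) (use S K(3) in blast)+
  ultimately show ?thesis by simp
qed

text \<open>Take the component A of V at x and the component B, at y, of the complement of the
  closure of A. Then \<open>X closure_of B\<close> and \<open>topspace X - B\<close> are connected
  closed sets covering X, and by unicoherence their intersection, the frontier of B, is connected.
  It lies in the closure of A but outside A, hence on the frontier of V.\<close>

lemma unicoherent_separation:
  assumes conn: "connected_space X" and lc: "locally_connected_space X" and uni: "unicoherent_space X"
    and V: "openin X V" and x: "x \<in> V" and y: "y \<in> topspace X - X closure_of V"
  obtains B where "openin X B" "connectedin X B" "connectedin X (topspace X - B)" "y \<in> B"
    "x \<notin> X closure_of B" "connectedin X (X frontier_of B)" "X frontier_of B \<subseteq> X frontier_of V"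
proof -
  obtain A where A: "openin X A" "connectedin X A" "x \<in> A" "A \<subseteq> V" "X closure_of A \<inter> V \<subseteq> A"
    by (rule open_component[OF lc V x]) blast
  let ?K = "X closure_of A"
  have Kt: "?K \<subseteq> topspace X" by (rule closure_of_subset_topspace)
  have AK: "A \<subseteq> ?K" using A(1) by (simp add: closure_of_subset openin_subset)
  have KV: "?K \<subseteq> X closure_of V" using A(4) by (rule closure_of_mono)
  have "openin X (topspace X - ?K)" by (intro openin_diff openin_topspace closedin_closure_of)
  moreover have "y \<in> topspace X - ?K" using y KV by blast
  ultimately obtain B where B: "openin X B" "connectedin X B" "y \<in> B" "B \<subseteq> topspace X - ?K"
      "X closure_of B \<inter> (topspace X - ?K) \<subseteq> B"
      "\<And>C. connectedin X C \<Longrightarrow> C \<subseteq> topspace X - ?K \<Longrightarrow> C \<inter> B \<noteq> {} \<Longrightarrow> C \<subseteq> B"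
    by (rule open_component[OF lc, of "topspace X - ?K" y]) blast
  have co: "connectedin X (topspace X - B)"
    using A(3) AK connectedin_closure_of[OF A(2)]
    by (intro connectedin_complement_component[OF conn lc _ _ _ B(1,4,6)]) auto
  have AB: "A \<inter> X closure_of B = {}"
    using A(1) AK B(4) by (subst openin_Int_closure_of_eq_empty) blast+
  have fr: "X frontier_of B = X closure_of B \<inter> (topspace X - B)"
    using B(1) closure_of_subset_topspace[of X B] by (auto simp: frontier_of_def interior_of_openin)
  have "X closure_of B \<union> (topspace X - B) = topspace X"
    using closure_of_subset_topspace[of X B] closure_of_subset[OF openin_subset[OF B(1)]] by blast
  then have "connectedin X (X frontier_of B)"
    unfolding fr
    using uni[unfolded unicoherent_space_def, rule_format, of "X closure_of B" "topspace X - B"]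
      co connectedin_closure_of[OF B(2)] closedin_diff[OF closedin_topspace B(1)] by simp
  moreover have "X frontier_of B \<subseteq> X frontier_of V"
  proof
    fix z assume z: "z \<in> X frontier_of B"
    then have "z \<in> ?K" using B(5) by (auto simp: fr)
    moreover have "z \<notin> A" using z AB by (auto simp: fr)
    ultimately have "z \<in> X closure_of V" "z \<notin> V" using KV A(5) by auto
    then show "z \<in> X frontier_of V" using V by (simp add: frontier_of_def interior_of_openin)
  qed
  moreover have "x \<notin> X closure_of B" using AB A(3) by blast
  ultimately show thesis by (intro that[OF B(1,2) co B(3)])
qed

lemma connectedin_dim_le_0:
  assumes "t1_space Y" and F: "subtopology Y F dim_le 0" and Q: "connectedin Y Q" "Q \<subseteq> F"
    and q: "a \<in> Q" "b \<in> Q"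
  shows "a = b"
proof (rule ccontr)
  assume "a \<noteq> b"
  let ?S = "subtopology Y F"
  have Qt: "Q \<subseteq> topspace Y" using Q(1) by (rule connectedin_subset_topspace)
  have "closedin ?S {b}"
    using t1_space_subtopology[OF assms(1), of F] q Q(2) Qt by (auto simp: t1_space_closedin_singleton)
  then have "openin ?S (topspace ?S - {b})" by (intro openin_diff openin_topspace)
  moreover have "a \<in> topspace ?S - {b}" using q Q(2) Qt \<open>a \<noteq> b\<close> by auto
  ultimately obtain U T where "openin ?S U" "closedin ?S T" "openin ?S T" "a \<in> U" "U \<subseteq> T" "T \<subseteq> topspace ?S - {b}"
    using F unfolding dimension_le_0_neighbourhood_base_of_clopen neighbourhood_base_of by metis
  then show False
    using connectedin_clopen_cases[of ?S Q T] Q q by (auto simp: connectedin_subtopology disjnt_iff)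
qed

text \<open>Small inductive dimension 1 supplies a neighbourhood U of \<open>\<phi> x\<close> with
  zero-dimensional frontier. The frontier of its preimage maps into that frontier, so a connected
  separator inside it maps to one point c. This c is outside U but in its closure, unlike
  \<open>\<phi> x\<close> and \<open>\<phi> y\<close>.\<close>

lemma curve_separation:
  assumes conn: "connected_space X" and lc: "locally_connected_space X" and uni: "unicoherent_space X"
    and \<phi>: "continuous_map X Y \<phi>" and Y: "Hausdorff_space Y" "Y dim_le 1"
    and xy: "x \<in> topspace X" "y \<in> topspace X" "\<phi> x \<noteq> \<phi> y"
  shows "\<exists>B c. openin X B \<and> connectedin X B \<and> connectedin X (topspace X - B) \<and> y \<in> B \<and> x \<notin> X closure_of B \<and>
        connectedin X (X frontier_of B) \<and> (\<forall>e\<in>X frontier_of B. \<phi> e = c) \<and> c \<noteq> \<phi> x \<and> c \<noteq> \<phi> y"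
proof -
  have \<phi>t: "\<phi> z \<in> topspace Y" if "z \<in> topspace X" for z
    using \<phi> that by (auto simp: continuous_map_def)
  obtain P Q where PQ: "openin Y P" "openin Y Q" "\<phi> x \<in> P" "\<phi> y \<in> Q" "disjnt P Q"
    using Y(1) xy \<phi>t unfolding Hausdorff_space_def by metis
  obtain U where U: "\<phi> x \<in> U" "U \<subseteq> P" "openin Y U" "subtopology Y (Y frontier_of U) dim_le (1 - 1)"
    using Y(2) PQ(1,3) by (cases rule: dimension_le.cases) blast
  have "Q \<inter> Y closure_of U = {}"
    using PQ(2,5) U(2) by (subst openin_Int_closure_of_eq_empty) (auto simp: disjnt_iff)
  then have ycl: "\<phi> y \<notin> Y closure_of U" using PQ(4) by blast
  define V where "V = {z \<in> topspace X. \<phi> z \<in> U}"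
  have V: "openin X V" unfolding V_def by (rule openin_continuous_map_preimage[OF \<phi> U(3)])
  have cl: "\<phi> z \<in> Y closure_of U" if "z \<in> X closure_of V" for z
  proof -
    have "\<phi> ` (X closure_of V) \<subseteq> Y closure_of (\<phi> ` V)" by (rule continuous_map_image_closure_subset[OF \<phi>])
    also have "\<dots> \<subseteq> Y closure_of U" by (rule closure_of_mono) (auto simp: V_def)
    finally show ?thesis using that by blast
  qed
  have fr: "\<phi> z \<in> Y frontier_of U" if "z \<in> X frontier_of V" for z
  proof -
    have "z \<in> X closure_of V" "z \<notin> V" "z \<in> topspace X"
      using that V frontier_of_subset_topspace[of X V] by (auto simp: frontier_of_def interior_of_openin)
    then show ?thesis using cl[of z] U(3) by (auto simp: V_def frontier_of_def interior_of_openin)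
  qed
  have "x \<in> V" "y \<in> topspace X - X closure_of V" using xy U(1) cl ycl by (auto simp: V_def)
  then obtain B where B: "openin X B" "connectedin X B" "connectedin X (topspace X - B)" "y \<in> B"
    "x \<notin> X closure_of B" "connectedin X (X frontier_of B)" "X frontier_of B \<subseteq> X frontier_of V"
    by (rule unicoherent_separation[OF conn lc uni V])
  have "x \<notin> B" using B(1,5) closure_of_subset[OF openin_subset] by blast
  then have "topspace X \<inter> X frontier_of B \<noteq> {}"
    using conn xy B(4) by (intro connectedin_Int_frontier_of) (auto simp: connectedin_topspace)
  then obtain e where e: "e \<in> X frontier_of B" by blast
  have "\<phi> e' = \<phi> e" if "e' \<in> X frontier_of B" for e'
    using Hausdorff_imp_t1_space[OF Y(1)] connectedin_continuous_map_image[OF \<phi> B(6)] U(4) fr B(7) e that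
    by (intro connectedin_dim_le_0[of Y "Y frontier_of U" "\<phi> ` (X frontier_of B)"]) auto
  moreover have "\<phi> e \<in> Y frontier_of U" using e B(7) fr by blast
  then have "\<phi> e \<noteq> \<phi> x" "\<phi> e \<noteq> \<phi> y"
    using U(1,3) ycl by (auto simp: frontier_of_def interior_of_openin)
  ultimately show ?thesis
    by (intro exI[of _ B] exI[of _ "\<phi> e"] conjI ballI B(1-6)) auto
qed

section \<open>Lifting circle-valued maps on a suspension\<close>

text \<open>M carries no metric here, so uniformity comes from a closed projection: the pairs (t,
  t') that violate the bound over some x are the image of a closed set under projection along the
  compact M, hence a compact set missing the diagonal.\<close>

lemma uniform_in_interval:
  fixes G :: "'a \<times> real \<Rightarrow> complex"
  assumes M: "compact_space M" and G: "continuous_map (prod_topology M (top_of_set {-1..1})) euclidean G"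
  obtains \<delta> where "\<delta> > 0" "\<And>x t t'. x \<in> topspace M \<Longrightarrow> t \<in> {-1..1} \<Longrightarrow> t' \<in> {-1..1} \<Longrightarrow> \<bar>t - t'\<bar> < \<delta> \<Longrightarrow>
    dist (G (x, t)) (G (x, t')) < 1"
proof -
  let ?I = "{-1..1::real}" and ?J = "{-1..1::real} \<times> {-1..1::real}"
  let ?W = "prod_topology M (top_of_set ?J)"
  define F where "F p = dist (G (fst p, fst (snd p))) (G (fst p, snd (snd p)))" for p
  have f1: "continuous_map ?W (prod_topology M (top_of_set ?I)) (\<lambda>p. (fst p, fst (snd p)))"
    and f2: "continuous_map ?W (prod_topology M (top_of_set ?I)) (\<lambda>p. (fst p, snd (snd p)))"
    unfolding prod_topology_subtopology_eu[symmetric]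
    by (intro continuous_map_pairedI continuous_map_fst continuous_map_compose[unfolded o_def, OF continuous_map_snd continuous_map_fst]
        continuous_map_compose[unfolded o_def, OF continuous_map_snd continuous_map_snd])+
  have p1: "continuous_map ?W (prod_topology euclidean euclidean) (\<lambda>p. (G (fst p, fst (snd p)), G (fst p, snd (snd p))))"
    by (intro continuous_map_pairedI continuous_map_compose[OF f1 G, unfolded o_def]
        continuous_map_compose[OF f2 G, unfolded o_def])
  have p2: "continuous_map (prod_topology euclidean euclidean) euclideanreal (\<lambda>q::complex \<times> complex. dist (fst q) (snd q))"
    by (simp add: continuous_map_iff_continuous2 continuous_intros)
  from continuous_map_compose[OF p1 p2] have contF: "continuous_map ?W euclideanreal F"
    by (simp only: o_def F_def[abs_def] fst_conv snd_conv)
  define C where "C = snd ` {p \<in> topspace ?W. F p \<in> {1..}}"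
  have "closedin ?W {p \<in> topspace ?W. F p \<in> {1..}}"
    by (rule closedin_continuous_map_preimage[OF contF]) auto
  then have "closedin (top_of_set ?J) C"
    unfolding C_def using Abstract_Topological_Spaces.closed_map_snd[OF M, of "top_of_set ?J"]
    by (auto simp: closed_map_def)
  moreover have "compact ?J" by (intro compact_Times) auto
  ultimately have "compact C" by (rule closedin_compact[rotated])
  have off: "fst q \<noteq> snd q" if "q \<in> C" for q
    using that by (auto simp: C_def F_def)
  have "\<exists>\<delta>>0. \<forall>q\<in>C. \<delta> \<le> \<bar>fst q - snd q\<bar>"
  proof (cases "C = {}")
    case False
    have "continuous_on C (\<lambda>q::real \<times> real. \<bar>fst q - snd q\<bar>)" by (intro continuous_intros)
    then obtain q where "q \<in> C" "\<forall>q'\<in>C. \<bar>fst q - snd q\<bar> \<le> \<bar>fst q' - snd q'\<bar>"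
      using continuous_attains_inf[OF \<open>compact C\<close> False] by blast
    then show ?thesis using off[of q] by (intro exI[of _ "\<bar>fst q - snd q\<bar>"]) auto
  qed (auto intro: zero_less_one)
  then obtain \<delta> where \<delta>: "\<delta> > 0" "\<And>q. q \<in> C \<Longrightarrow> \<delta> \<le> \<bar>fst q - snd q\<bar>" by blast
  show thesis
  proof (rule that[OF \<delta>(1)])
    fix x t t' assume *: "x \<in> topspace M" "t \<in> ?I" "t' \<in> ?I" "\<bar>t - t'\<bar> < \<delta>"
    show "dist (G (x, t)) (G (x, t')) < 1"
    proof (rule ccontr)
      assume "\<not> ?thesis"
      then have "(t, t') \<in> C"
        using * unfolding C_def by (intro image_eqI[of _ _ "(x, (t, t'))"]) (auto simp: F_def)
      then show False using \<delta>(2)[of "(t, t')"] * by simp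
    qed
  qed
qed

text \<open>The interval is cut into N steps so short that consecutive values of G differ by less
  than 1. Their quotients avoid the branch cut of the logarithm, and the sum of the principal
  arguments is the lift.\<close>

lemma circle_lift:
  fixes G :: "'a \<times> real \<Rightarrow> complex"
  assumes M: "compact_space M" and G: "continuous_map (prod_topology M (top_of_set {-1..1})) euclidean G"
    and norm: "\<And>x t. x \<in> topspace M \<Longrightarrow> t \<in> {-1..1} \<Longrightarrow> norm (G (x, t)) = 1"
  obtains \<theta> where "continuous_map (prod_topology M (top_of_set {-1..1})) euclideanreal \<theta>"
    "\<And>x t. x \<in> topspace M \<Longrightarrow> t \<in> {-1..1} \<Longrightarrow> G (x, t) = G (x, -1) * cis (\<theta> (x, t))"
    "\<And>x. x \<in> topspace M \<Longrightarrow> \<theta> (x, -1) = 0"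
proof -
  let ?I = "{-1..1::real}" and ?Z = "prod_topology M (top_of_set {-1..1})"
  obtain \<delta> where \<delta>: "\<delta> > 0" "\<And>x t t'. x \<in> topspace M \<Longrightarrow> t \<in> ?I \<Longrightarrow> t' \<in> ?I \<Longrightarrow> \<bar>t - t'\<bar> < \<delta> \<Longrightarrow>
      dist (G (x, t)) (G (x, t')) < 1"
    using uniform_in_interval[OF M G] by blast
  obtain N :: nat where "2 / \<delta> < real N" using reals_Archimedean2 by blast
  then have N: "0 < N" "2 / real N < \<delta>"
    using \<delta>(1) by (auto simp: divide_less_eq mult.commute intro: gr0I)
  \<comment> \<open>This is a walk on a grid from -1, stopped at t. It starts at
    \<open>u 0 t = -1\<close>, ends at \<open>u N t = t\<close>, and is continuous in t at each
    step.\<close>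
  define u where "u k t = min t (-1 + 2 * real k / real N)" for k :: nat and t
  have u_I: "u k t \<in> ?I" if "t \<in> ?I" for k t using that by (auto simp: u_def)
  have u_step: "\<bar>u (Suc k) t - u k t\<bar> < \<delta>" for k t
  proof -
    have "2 * real (Suc k) / real N = 2 * real k / real N + 2 / real N"
      by (simp add: add_divide_distrib)
    moreover have "0 \<le> 2 / real N" by simp
    ultimately have "\<bar>u (Suc k) t - u k t\<bar> \<le> 2 / real N" unfolding u_def by linarith
    then show ?thesis using N(2) by linarith
  qed
  define g where "g k z = G (fst z, u k (snd z))" for k z
  have g_cont: "continuous_map ?Z euclidean (g k)" for k
  proof -
    have "continuous_map (top_of_set ?I) (top_of_set ?I) (u k)"
      using u_I by (auto simp: continuous_map_in_subtopology u_def[abs_def] intro!: continuous_intros)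
    then have "continuous_map ?Z ?Z (\<lambda>z. (fst z, u k (snd z)))"
      by (intro continuous_map_pairedI continuous_map_fst continuous_map_compose[unfolded o_def, OF continuous_map_snd])
    from continuous_map_compose[OF this G] show ?thesis by (simp add: o_def g_def[abs_def])
  qed
  define S where "S = {(a, b). norm a = 1 \<and> norm b = 1 \<and> dist a b < (1::real)} \<inter> (UNIV :: (complex \<times> complex) set)"
  have S: "a / b \<notin> \<real>\<^sub>\<le>\<^sub>0" "b \<noteq> 0" "norm (a / b) = 1" if "(a, b) \<in> S" for a b
  proof -
    have ab: "norm a = 1" "norm b = 1" "dist a b < 1" using that by (auto simp: S_def)
    then show "b \<noteq> 0" "norm (a / b) = 1" by (auto simp: norm_divide)
    have "norm (a / b - 1) = norm (a - b) / norm b"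
      using \<open>b \<noteq> 0\<close> by (simp add: norm_divide[symmetric] diff_divide_distrib)
    then have "norm (a / b - 1) < 1" using ab by (simp add: dist_norm)
    then have "0 < Re (a / b)"
      using abs_Re_le_cmod[of "a / b - 1"] by (simp add: abs_le_iff)
    then show "a / b \<notin> \<real>\<^sub>\<le>\<^sub>0" by (auto simp: complex_nonpos_Reals_iff)
  qed
  define A where "A q = Im (Ln (fst q / snd q))" for q
  have A_cont: "continuous_on S A"
    unfolding A_def using S by (intro continuous_intros) auto
  have A_cis: "a = b * cis (A (a, b))" if "(a, b) \<in> S" for a b
  proof -
    have nz: "a / b \<noteq> 0" using S(3)[OF that] by (metis norm_zero zero_neq_one)
    have "Re (Ln (a / b)) = 0" unfolding Re_Ln[OF nz] S(3)[OF that] by simp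
    then have "exp (Ln (a / b)) = cis (A (a, b))" by (simp add: A_def exp_eq_polar)
    moreover have "exp (Ln (a / b)) = a / b"
      by (rule exp_Ln[OF nz])
    ultimately show ?thesis using S(2)[OF that] by (simp add: field_simps)
  qed
  have gS: "(g (Suc k) z, g k z) \<in> S" if "z \<in> topspace ?Z" for k z
  proof -
    obtain x t where z: "z = (x, t)" "x \<in> topspace M" "t \<in> ?I" using \<open>z \<in> topspace ?Z\<close> by auto
    show ?thesis using norm[OF z(2) u_I[OF z(3)]] \<delta>(2)[OF z(2) u_I[OF z(3)] u_I[OF z(3)] u_step]
      by (simp add: S_def g_def z(1))
  qed
  define \<theta> where "\<theta> z = (\<Sum>k<N. A (g (Suc k) z, g k z))" for z
  have "continuous_map ?Z euclideanreal (\<lambda>z. A (g (Suc k) z, g k z))" for k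
  proof -
    have "continuous_map ?Z (prod_topology euclidean euclidean) (\<lambda>z. (g (Suc k) z, g k z))"
      by (intro continuous_map_pairedI g_cont)
    then have p1: "continuous_map ?Z (top_of_set S) (\<lambda>z. (g (Suc k) z, g k z))"
      using gS by (auto simp: continuous_map_in_subtopology)
    have p2: "continuous_map (top_of_set S) euclideanreal A" using A_cont by simp
    from continuous_map_compose[OF p1 p2] show ?thesis by (simp only: o_def)
  qed
  then have "continuous_map ?Z euclideanreal \<theta>"
    unfolding \<theta>_def by (intro continuous_map_sum) auto
  moreover have partial: "g n z = g 0 z * cis (\<Sum>k<n. A (g (Suc k) z, g k z))" if "z \<in> topspace ?Z" for n z
  proof (induction n)
    case (Suc n)
    have "g (Suc n) z = g n z * cis (A (g (Suc n) z, g n z))" by (rule A_cis[OF gS[OF that]])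
    also have "\<dots> = g 0 z * (cis (\<Sum>k<n. A (g (Suc k) z, g k z)) * cis (A (g (Suc n) z, g n z)))"
      using Suc by simp
    finally show ?case by (simp add: cis_mult)
  qed simp
  have "G (x, t) = G (x, -1) * cis (\<theta> (x, t))" if "x \<in> topspace M" "t \<in> ?I" for x t
  proof -
    have "u N t = t" "u 0 t = -1" using N(1) that(2) by (auto simp: u_def)
    then show ?thesis using partial[of "(x, t)" N] that by (simp add: g_def \<theta>_def)
  qed
  moreover have "\<theta> (x, -1) = 0" if "x \<in> topspace M" for x
  proof -
    have "u k (-1) = -1" for k by (simp add: u_def)
    then have "g k (x, -1) = G (x, -1)" for k by (simp add: g_def)
    then show ?thesis using norm[OF that, of "-1"] by (cases "G (x, -1) = 0") (simp_all add: \<theta>_def A_def)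
  qed
  ultimately show thesis by (rule that)
qed

text \<open>The values of f on S differ from \<open>f x\<close> by integer multiples of 2 pi and so
  are countably many, whereas a connected set of reals with two points is uncountable.\<close>

lemma cis_constant_lift:
  fixes f :: "'a \<Rightarrow> real"
  assumes S: "connectedin X S" and f: "continuous_map (subtopology X S) euclideanreal f"
    and c: "\<And>x y. x \<in> S \<Longrightarrow> y \<in> S \<Longrightarrow> cis (f x) = cis (f y)"
    and xy: "x \<in> S" "y \<in> S"
  shows "f x = f y"
proof (rule ccontr)
  assume "f x \<noteq> f y"
  have "connectedin (subtopology X S) S" using S by (simp add: connectedin_subtopology)
  from connectedin_continuous_map_image[OF f this] have "connected (f ` S)" by simp
  then have "uncountable (f ` S)"
    using connected_uncountable[of "f ` S" "f x" "f y"] xy \<open>f x \<noteq> f y\<close> by simp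
  moreover have "f ` S \<subseteq> range (\<lambda>n::int. f x + 2 * pi * of_int n)"
  proof
    fix v assume "v \<in> f ` S"
    then obtain z where z: "z \<in> S" "v = f z" by blast
    then have "sin (f z) = sin (f x) \<and> cos (f z) = cos (f x)"
      using c[OF z(1) xy(1)] by (simp add: complex_eq_iff)
    then show "v \<in> range (\<lambda>n::int. f x + 2 * pi * of_int n)"
      unfolding sin_cos_eq_iff using z(2) by blast
  qed
  then have "countable (f ` S)" by (rule countable_subset) simp
  ultimately show False by simp
qed

text \<open>The angle is lifted along the suspension coordinate, starting with 0 at the bottom. At
  the top g is constant, so the angle is constant there modulo 2 pi and, M being connected,
  constant. Hence it descends to the suspension.\<close>

lemma circle_lift_suspension:
  fixes g :: "'b \<Rightarrow> complex" and \<psi> :: "'a \<times> real \<Rightarrow> 'b"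
  assumes M: "compact_space M" "connected_space M"
    and \<psi>: "quotient_map (prod_topology M (top_of_set {-1..1})) X \<psi>"
    and fib: "\<And>p q. p \<in> topspace M \<times> {-1..1} \<Longrightarrow> q \<in> topspace M \<times> {-1..1} \<Longrightarrow>
      \<psi> p = \<psi> q \<longleftrightarrow> p = q \<or> snd p = 1 \<and> snd q = 1 \<or> snd p = -1 \<and> snd q = -1"
    and g: "continuous_map X euclidean g" and norm: "\<And>x. x \<in> topspace X \<Longrightarrow> norm (g x) = 1"
  obtains \<theta> c where "continuous_map X euclideanreal \<theta>" "\<And>x. x \<in> topspace X \<Longrightarrow> g x = c * cis (\<theta> x)"
proof (cases "topspace M = {}")
  case True
  then have "topspace X = {}" using quotient_imp_surjective_map[OF \<psi>] by auto
  then show thesis using that[of "\<lambda>_. 0" 1] by simp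
next
  case False
  then obtain x0 where x0: "x0 \<in> topspace M" by blast
  let ?Z = "prod_topology M (top_of_set {-1..1::real})"
  have cont: "continuous_map ?Z X \<psi>" using \<psi> by (rule quotient_imp_continuous_map)
  have \<psi>t: "\<psi> (x, t) \<in> topspace X" if "x \<in> topspace M" "t \<in> {-1..1}" for x t
    using cont that by (auto simp: continuous_map_def)
  have G: "continuous_map ?Z euclidean (g \<circ> \<psi>)" by (rule continuous_map_compose[OF cont g])
  obtain \<theta> where \<theta>: "continuous_map ?Z euclideanreal \<theta>"
    "\<And>x t. x \<in> topspace M \<Longrightarrow> t \<in> {-1..1} \<Longrightarrow> (g \<circ> \<psi>) (x, t) = (g \<circ> \<psi>) (x, -1) * cis (\<theta> (x, t))"
    "\<And>x. x \<in> topspace M \<Longrightarrow> \<theta> (x, -1) = 0"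
    using circle_lift[OF M(1) G] norm \<psi>t by auto
  have bot: "g (\<psi> (x, -1)) = g (\<psi> (x0, -1))" and top: "g (\<psi> (x, 1)) = g (\<psi> (x0, 1))"
    if "x \<in> topspace M" for x
    using fib[of "(x, -1)" "(x0, -1)"] fib[of "(x, 1)" "(x0, 1)"] that x0 by simp_all
  have nz: "g (\<psi> (x0, -1)) \<noteq> 0" using norm[OF \<psi>t[OF x0, of "-1"]] by auto
  have cis_eq: "cis (\<theta> (x, t)) = g (\<psi> (x, t)) / g (\<psi> (x0, -1))" if "x \<in> topspace M" "t \<in> {-1..1}" for x t
    using \<theta>(2)[OF that] bot[OF that(1)] nz by (simp add: field_simps)
  have top_const: "\<theta> (x, 1) = \<theta> (x0, 1)" if "x \<in> topspace M" for x
  proof (rule cis_constant_lift[of M "topspace M" "\<lambda>x. \<theta> (x, 1)"])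
    have "continuous_map M ?Z (\<lambda>x. (x, 1))" by (simp add: continuous_map_pairedI)
    from continuous_map_compose[OF this \<theta>(1)]
    show "continuous_map (subtopology M (topspace M)) euclideanreal (\<lambda>x. \<theta> (x, 1))" by (simp add: o_def)
    show "connectedin M (topspace M)" using M(2) by (simp add: connectedin_topspace)
    show "cis (\<theta> (y, 1)) = cis (\<theta> (z, 1))" if "y \<in> topspace M" "z \<in> topspace M" for y z
      using cis_eq[of y 1] cis_eq[of z 1] top[OF that(1)] top[OF that(2)] that by simp
  qed (use x0 that in simp_all)
  have factor: "\<theta> p = \<theta> q" if "p \<in> topspace ?Z" "q \<in> topspace ?Z" "\<psi> p = \<psi> q" for p q
  proof -
    have pq: "p \<in> topspace M \<times> {-1..1}" "q \<in> topspace M \<times> {-1..1}" using that(1,2) by auto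
    from fib[OF pq] that(3)
    consider "p = q" | "snd p = 1" "snd q = 1" | "snd p = -1" "snd q = -1" by argo
    then show ?thesis
    proof cases
      case 2
      then have "p = (fst p, 1)" "q = (fst q, 1)" by (simp_all add: prod_eq_iff)
      then show ?thesis using top_const[of "fst p"] top_const[of "fst q"] pq by (metis mem_Times_iff)
    next
      case 3
      then have "p = (fst p, -1)" "q = (fst q, -1)" by (simp_all add: prod_eq_iff)
      then show ?thesis using \<theta>(3)[of "fst p"] \<theta>(3)[of "fst q"] pq by (metis mem_Times_iff)
    qed simp
  qed
  obtain \<theta>' where \<theta>': "continuous_map X euclideanreal \<theta>'" "\<And>p. p \<in> topspace ?Z \<Longrightarrow> \<theta>' (\<psi> p) = \<theta> p"
    by (rule quotient_map_lift_exists[OF \<psi> \<theta>(1) factor]) blast+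
  show thesis
  proof (rule that[OF \<theta>'(1)])
    fix x assume "x \<in> topspace X"
    then obtain p where p: "p \<in> topspace ?Z" "x = \<psi> p" unfolding quotient_imp_surjective_map[OF \<psi>, symmetric] by blast
    then show "g x = g (\<psi> (x0, -1)) * cis (\<theta>' x)"
      using \<theta>'(2)[OF p(1)] \<theta>(2)[of "fst p" "snd p"] bot[of "fst p"] by auto
  qed
qed

text \<open>If the intersection fell into two closed pieces, a Urysohn function u for them would
  define a circle-valued g that makes a half turn on A and the opposite half turn on B. Between the
  same two points, a lift of g would have to change by pi along A and by -pi along B.\<close>

lemma unicoherent_suspension:
  fixes \<psi> :: "'a \<times> real \<Rightarrow> 'b"
  assumes M: "compact_space M" "connected_space M"
    and \<psi>: "quotient_map (prod_topology M (top_of_set {-1..1})) X \<psi>"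
    and fib: "\<And>p q. p \<in> topspace M \<times> {-1..1} \<Longrightarrow> q \<in> topspace M \<times> {-1..1} \<Longrightarrow>
      \<psi> p = \<psi> q \<longleftrightarrow> p = q \<or> snd p = 1 \<and> snd q = 1 \<or> snd p = -1 \<and> snd q = -1"
    and X: "normal_space X"
  shows "unicoherent_space X"
  unfolding unicoherent_space_def
proof (intro allI impI, elim conjE)
  fix A B assume A: "closedin X A" "connectedin X A" and B: "closedin X B" "connectedin X B"
    and un: "A \<union> B = topspace X"
  show "connectedin X (A \<inter> B)"
  proof (rule ccontr)
    assume "\<not> ?thesis"
    then obtain E1 E2 where E: "closedin X E1" "closedin X E2" "A \<inter> B \<subseteq> E1 \<union> E2"
      "E1 \<inter> E2 \<inter> (A \<inter> B) = {}" "E1 \<inter> (A \<inter> B) \<noteq> {}" "E2 \<inter> (A \<inter> B) \<noteq> {}"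
      unfolding connectedin_closedin using un by blast
    let ?C = "E1 \<inter> (A \<inter> B)" and ?D = "E2 \<inter> (A \<inter> B)"
    have CD: "closedin X ?C" "closedin X ?D" "disjnt ?C ?D"
      using E A B by (auto simp: disjnt_def)
    obtain u where u: "continuous_map X euclideanreal u" "u ` ?C \<subseteq> {0::real}" "u ` ?D \<subseteq> {1}"
      by (rule Urysohn_lemma_alt[OF X CD])
    note u' = u(1)
    define g where "g x = (if x \<in> A then cis (pi * u x) else cis (- pi * u x))" for x
    have cis_u: "continuous_map (subtopology X S) euclidean (\<lambda>x. cis (k * u x))" for k S
    proof -
      have "continuous_map euclideanreal euclidean (\<lambda>t. cis (k * t))"
        by (simp add: continuous_map_iff_continuous2 continuous_intros)
      from continuous_map_compose[OF continuous_map_from_subtopology[OF u'] this]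
      show ?thesis by (simp add: o_def)
    qed
    have cont_g: "continuous_map X euclidean g" unfolding g_def
    proof (rule continuous_map_cases[OF cis_u cis_u])
      \<comment> \<open>The frontier of A lies in both A and B, where u is 0 or 1; at these values
        the two half turns agree.\<close>
      fix x assume x: "x \<in> X frontier_of {x. x \<in> A}"
      then have "x \<in> A" using A(1) by (simp add: frontier_of_def closure_of_closedin)
      moreover have "x \<in> X closure_of (topspace X - A)"
        using x by (simp add: frontier_of_closures)
      then have "x \<in> B" using closure_of_minimal[of "topspace X - A" B X] B(1) un by blast
      ultimately have "u x = 0 \<or> u x = 1" using E(3) u(2,3) by blast
      then show "cis (pi * u x) = cis (- pi * u x)" by (auto simp: cis.code)
    qed
    obtain \<theta> c where \<theta>: "continuous_map X euclideanreal \<theta>" and g: "\<And>x. x \<in> topspace X \<Longrightarrow> g x = c * cis (\<theta> x)"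
    proof (rule circle_lift_suspension[OF M \<psi> _ cont_g])
      show "\<psi> p = \<psi> q \<longleftrightarrow> p = q \<or> snd p = 1 \<and> snd q = 1 \<or> snd p = -1 \<and> snd q = -1"
        if "p \<in> topspace M \<times> {-1..1}" "q \<in> topspace M \<times> {-1..1}" for p q
        by (rule fib[OF that])
      show "norm (g x) = 1" for x by (simp add: g_def)
    qed blast
    obtain p q where p: "p \<in> E1" "p \<in> A" "p \<in> B" and q: "q \<in> E2" "q \<in> A" "q \<in> B" using E by blast
    have At: "A \<subseteq> topspace X" and Bt: "B \<subseteq> topspace X" using un by auto
    have up: "u p = 0" and uq: "u q = 1" using u p q by blast+
    have nz: "c \<noteq> 0" using g[of p] p At by (auto simp: g_def)
    have shift: "cis (a - b) = 1 / c" if "cis b = c * cis a" for a b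
      unfolding cis_divide[symmetric] that using nz by simp
    have gB: "g x = cis (- pi * u x)" if "x \<in> B" for x
    proof (cases "x \<in> A")
      case True
      then have "u x = 0 \<or> u x = 1" using E(3) u(2,3) that by blast
      then show ?thesis by (auto simp: g_def cis.code)
    qed (simp add: g_def)
    have cd: "continuous_map (subtopology X S) euclideanreal (\<lambda>x. \<theta> x - k * u x)" for S k
      by (intro continuous_map_diff continuous_map_real_mult continuous_map_from_subtopology[OF \<theta>]
          continuous_map_from_subtopology[OF u']) auto
    have "\<theta> p - pi * u p = \<theta> q - pi * u q"
    proof (rule cis_constant_lift[OF A(2) cd _ p(2) q(2)])
      have "cis (\<theta> x - pi * u x) = 1 / c" if "x \<in> A" for x
        using g[of x] that At by (intro shift) (auto simp: g_def)
      then show "cis (\<theta> x - pi * u x) = cis (\<theta> y - pi * u y)" if "x \<in> A" "y \<in> A" for x y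
        using that by simp
    qed
    moreover have "\<theta> p - (- pi) * u p = \<theta> q - (- pi) * u q"
    proof (rule cis_constant_lift[OF B(2) cd _ p(3) q(3)])
      have "cis (\<theta> x - (- pi) * u x) = 1 / c" if "x \<in> B" for x
        using g[of x] gB[OF that] that Bt by (intro shift) auto
      then show "cis (\<theta> x - (- pi) * u x) = cis (\<theta> y - (- pi) * u y)" if "x \<in> B" "y \<in> B" for x y
        using that by simp
    qed
    ultimately show False using up uq by simp
  qed
qed

section \<open>Suspensions in products of curves\<close>

lemma tree_pullback:
  assumes T: "tree_structure X s \<mu>" and f: "continuous_map Y X f"
  shows "tree_structure Y (\<lambda>y. s (f y)) (\<lambda>y z. \<mu> (f y) (f z))"
proof -
  have ft: "f y \<in> topspace X" if "y \<in> topspace Y" for y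
    using f that by (auto simp: continuous_map_def)
  have near: "\<exists>U. openin Y U \<and> y \<in> U \<and> (\<forall>z\<in>U. \<forall>w\<in>U. s (f y) - \<epsilon> < \<mu> (f z) (f w))"
    if y: "y \<in> topspace Y" and "\<epsilon> > 0" for y \<epsilon>
  proof -
    obtain U where U: "openin X U" "f y \<in> U" "\<forall>z\<in>U. \<forall>w\<in>U. s (f y) - \<epsilon> < \<mu> z w"
      using tree_near[OF T ft[OF y] \<open>\<epsilon> > 0\<close>] by blast
    show ?thesis
      by (intro exI[of _ "{z \<in> topspace Y. f z \<in> U}"] conjI openin_continuous_map_preimage[OF f U(1)])
        (use U y in auto)
  qed
  have "continuous_map Y euclideanreal (\<lambda>y. s (f y))"
    using continuous_map_compose[OF f tree_cont[OF T]] by (simp add: o_def)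
  then show ?thesis unfolding tree_structure_def
    using near tree_sym[OF T] tree_le1[OF T] tree_ultra[OF T] ft by simp
qed

text \<open>A continuous injection of the cube is all that is asked of a cell: the trees are pulled
  back along it to the cube, where \<open>tree_product_no_peak\<close> applies.\<close>

lemma manifold_point_no_peak:
  assumes T: "\<And>i. i < m \<Longrightarrow> tree_structure X (h i) (\<mu> i)"
    and pos: "\<And>i x y. i < m \<Longrightarrow> x \<in> topspace X \<Longrightarrow> y \<in> topspace X \<Longrightarrow> 0 \<le> \<mu> i x y"
    and inj: "\<And>x y. x \<in> topspace X \<Longrightarrow> y \<in> topspace X \<Longrightarrow>
      (\<And>i. i < m \<Longrightarrow> h i x \<le> \<mu> i x y \<and> h i y \<le> \<mu> i x y) \<Longrightarrow> x = y"
    and "m > 0"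
    and e: "continuous_map (top_of_set (sym_cube m)) X e" "inj_on e (sym_cube m)" "e (\<lambda>_. 0) = q"
  shows "\<exists>z\<in>topspace X. z \<noteq> q \<and> (\<forall>i<m. h i q \<le> \<mu> i q z)"
proof -
  have et: "e b \<in> topspace X" if "b \<in> sym_cube m" for b
    using e(1) that by (auto simp: continuous_map_def)
  have "\<exists>b\<in>sym_cube m. b \<noteq> (\<lambda>_. 0) \<and> (\<forall>i<m. h i (e (\<lambda>_. 0)) \<le> \<mu> i (e (\<lambda>_. 0)) (e b))"
  proof (rule tree_product_no_peak[where h = "\<lambda>i b. h i (e b)" and \<mu> = "\<lambda>i b c. \<mu> i (e b) (e c)"])
    show "tree_structure (top_of_set (sym_cube m)) (\<lambda>b. h i (e b)) (\<lambda>b c. \<mu> i (e b) (e c))" if "i < m" for i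
      by (rule tree_pullback[OF T[OF that] e(1)])
    show "b = c" if "b \<in> sym_cube m" "c \<in> sym_cube m"
      "\<And>i. i < m \<Longrightarrow> h i (e b) \<le> \<mu> i (e b) (e c) \<and> h i (e c) \<le> \<mu> i (e b) (e c)" for b c
      using inj[OF et[OF that(1)] et[OF that(2)] that(3)] e(2) that(1,2) by (simp add: inj_on_eq_iff)
  qed (use pos et \<open>m > 0\<close> in auto)
  then obtain b where b: "b \<in> sym_cube m" "b \<noteq> (\<lambda>_. 0)" "\<forall>i<m. h i q \<le> \<mu> i q (e b)"
    unfolding e(3) by blast
  have "e b \<noteq> q" using b(1,2) e(2,3) sym_cube_zero[of m] by (metis inj_on_eq_iff)
  then show ?thesis using b et by blast
qed

lemma compact_space_attains_sup:
  fixes f :: "'a \<Rightarrow> real"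
  assumes S: "compactin X S" "S \<noteq> {}" and f: "continuous_map X euclideanreal f"
  obtains a where "a \<in> S" "\<And>x. x \<in> S \<Longrightarrow> f x \<le> f a"
proof -
  have "compact (f ` S)" using image_compactin[OF S(1) f] by simp
  then show thesis using compact_attains_sup[of "f ` S"] S(2) that by auto
qed

text \<open>One height is replaced so that the total height becomes plus or minus l up to a
  constant. A point of maximal total height is a peak for the merge trees of the new heights,
  because heights cannot drop on the way up. The new heights still separate points, since l and the
  height of index c' determine that of index c.\<close>

lemma no_injection_of_suspension_like:
  assumes X: "compact_space X" "connected_space X" "locally_connected_space X"
    and h: "\<And>i. i < m \<Longrightarrow> continuous_map X euclideanreal (h i)"
      "\<And>i x. i < m \<Longrightarrow> x \<in> topspace X \<Longrightarrow> 0 \<le> h i x"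
    and inj: "\<And>x y. x \<in> topspace X \<Longrightarrow> y \<in> topspace X \<Longrightarrow> (\<And>i. i < m \<Longrightarrow> h i x = h i y) \<Longrightarrow> x = y"
    and "m \<ge> 2"
    and P: "p1 \<in> topspace X" "p2 \<in> topspace X" "\<exists>q\<in>topspace X. q \<noteq> p1 \<and> q \<noteq> p2"
    and charts: "\<And>q. q \<in> topspace X \<Longrightarrow> q \<noteq> p1 \<Longrightarrow> q \<noteq> p2 \<Longrightarrow>
      \<exists>e. continuous_map (top_of_set (sym_cube m)) X e \<and> inj_on e (sym_cube m) \<and> e (\<lambda>_. 0) = q"
  shows False
proof -
  \<comment> \<open>Two coordinates suffice for a functional that agrees on the poles. Its
    coefficient at c is 1, so the height of index c can be recovered from it.\<close>
  have "\<exists>c c' k. c < m \<and> c' < m \<and> c \<noteq> c' \<and> h c p1 - k * h c' p1 = h c p2 - k * h c' p2"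
  proof (cases "h 0 p1 = h 0 p2")
    case True
    then show ?thesis using \<open>m \<ge> 2\<close> by (intro exI[of _ 0] exI[of _ 1] exI[of _ "0::real"]) auto
  next
    case False
    then show ?thesis using \<open>m \<ge> 2\<close>
      by (intro exI[of _ 1] exI[of _ 0] exI[of _ "(h 1 p1 - h 1 p2) / (h 0 p1 - h 0 p2)"]) (auto simp: field_simps)
  qed
  then obtain c c' k where c: "c < m" "c' < m" "c \<noteq> c'" "h c p1 - k * h c' p1 = h c p2 - k * h c' p2"
    by blast
  define l where "l x = h c x - k * h c' x" for x
  have cont_l: "continuous_map X euclideanreal l"
    unfolding l_def by (intro continuous_map_diff continuous_map_real_mult h(1) c) auto
  have l12: "l p1 = l p2" using c(4) by (simp add: l_def)
  have comp: "compactin X (topspace X)" using X(1) by (simp add: compact_space_def)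
  have ne: "topspace X \<noteq> {}" using P(1) by blast
  obtain a where a: "a \<in> topspace X" "\<And>x. x \<in> topspace X \<Longrightarrow> l x \<le> l a"
    using compact_space_attains_sup[OF comp ne cont_l] by blast
  obtain b where b: "b \<in> topspace X" "\<And>x. x \<in> topspace X \<Longrightarrow> - l x \<le> - l b"
    using compact_space_attains_sup[OF comp ne continuous_map_minus[OF cont_l]] by blast
  \<comment> \<open>If maximum and minimum both equal the common value at the poles, l is constant
    and any third point serves.\<close>
  have "\<exists>q \<sigma>. q \<in> topspace X \<and> q \<noteq> p1 \<and> q \<noteq> p2 \<and> (\<sigma> = 1 \<or> \<sigma> = (-1::real)) \<and>
      (\<forall>x\<in>topspace X. \<sigma> * l x \<le> \<sigma> * l q)"
  proof -
    consider "l a \<noteq> l p1" | "l b \<noteq> l p1" | "l a = l p1" "l b = l p1" by blast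
    then show ?thesis
    proof cases
      case 1
      then show ?thesis using a l12 by (intro exI[of _ a] exI[of _ "1::real"]) auto
    next
      case 2
      then show ?thesis using b l12 by (intro exI[of _ b] exI[of _ "-1::real"]) auto
    next
      case 3
      then have "l x = l p1" if "x \<in> topspace X" for x using a(2)[OF that] b(2)[OF that] by simp
      then show ?thesis using P(3) by (metis order_refl)
    qed
  qed
  then obtain q \<sigma> where q: "q \<in> topspace X" "q \<noteq> p1" "q \<noteq> p2" and \<sigma>: "\<sigma> = 1 \<or> \<sigma> = (-1::real)"
    and qmax: "\<And>x. x \<in> topspace X \<Longrightarrow> \<sigma> * l x \<le> \<sigma> * l q" by blast
  define rest where "rest x = \<sigma> * l x - (\<Sum>i\<in>{..<m} - {c}. h i x)" for x
  have cont_rest: "continuous_map X euclideanreal rest"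
    unfolding rest_def
    by (intro continuous_map_diff continuous_map_real_mult continuous_map_sum cont_l h(1)) auto
  \<comment> \<open>The minimum of \<open>rest\<close>, attained at r, is subtracted to keep the new
    height nonnegative.\<close>
  obtain r where r: "\<And>x. x \<in> topspace X \<Longrightarrow> - rest x \<le> - rest r"
    using compact_space_attains_sup[OF comp ne continuous_map_minus[OF cont_rest]] by blast
  define h' where "h' i x = (if i = c then rest x - rest r else h i x)" for i x
  have h': "continuous_map X euclideanreal (h' i)" "\<And>x. x \<in> topspace X \<Longrightarrow> 0 \<le> h' i x" if "i < m" for i
  proof -
    show "continuous_map X euclideanreal (h' i)"
      using h(1)[OF that] cont_rest unfolding h'_def
      by (cases "i = c") (auto intro!: continuous_map_diff)
    show "0 \<le> h' i x" if "x \<in> topspace X" for x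
      using h(2)[OF \<open>i < m\<close> that] r[OF that] by (simp add: h'_def)
  qed
  have sum_h': "(\<Sum>i<m. h' i x) = \<sigma> * l x - rest r" for x
  proof -
    have "(\<Sum>i<m. h' i x) = h' c x + (\<Sum>i\<in>{..<m} - {c}. h' i x)"
      using c(1) by (simp add: sum.remove)
    also have "(\<Sum>i\<in>{..<m} - {c}. h' i x) = (\<Sum>i\<in>{..<m} - {c}. h i x)"
      by (intro sum.cong) (auto simp: h'_def)
    finally show ?thesis by (simp add: h'_def rest_def)
  qed
  have inj': "x = y" if xy: "x \<in> topspace X" "y \<in> topspace X" and eq: "\<And>i. i < m \<Longrightarrow> h' i x = h' i y" for x y
  proof (rule inj[OF xy])
    have off: "h i x = h i y" if "i < m" "i \<noteq> c" for i using eq[OF that(1)] that(2) by (simp add: h'_def)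
    have "(\<Sum>i<m. h' i x) = (\<Sum>i<m. h' i y)" using eq by (intro sum.cong) auto
    then have "l x = l y" using sum_h' \<sigma> by auto
    then have "h c x = h c y" using off[OF c(2)] c(3) by (simp add: l_def)
    then show "h i x = h i y" if "i < m" for i using off that by (cases "i = c") auto
  qed
  have T': "tree_structure X (h' i) (merge_level X (h' i))" if "i < m" for i
    using tree_structure_merge_level[OF X(2) h'(2)[OF that] X(3) h'(1)[OF that]] .
  obtain e where e: "continuous_map (top_of_set (sym_cube m)) X e" "inj_on e (sym_cube m)" "e (\<lambda>_. 0) = q"
    using charts[OF q] by blast
  have "\<exists>z\<in>topspace X. z \<noteq> q \<and> (\<forall>i<m. h' i q \<le> merge_level X (h' i) q z)"
  proof (rule manifold_point_no_peak[OF T' _ _ _ e])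
    show "0 \<le> merge_level X (h' i) x y" if "i < m" "x \<in> topspace X" "y \<in> topspace X" for i x y
      by (rule merge_level_bound[OF X(2) h'(2)[OF that(1)] that(2,3)])
    show "x = y" if "x \<in> topspace X" "y \<in> topspace X"
      "\<And>i. i < m \<Longrightarrow> h' i x \<le> merge_level X (h' i) x y \<and> h' i y \<le> merge_level X (h' i) x y" for x y
    proof (rule inj'[OF that(1,2)])
      fix i assume i: "i < m"
      show "h' i x = h' i y"
        using that(3)[OF i] tree_le1[OF T'[OF i] that(1,2)] tree_le2[OF T'[OF i] that(1,2)] by linarith
    qed
  qed (use \<open>m \<ge> 2\<close> in auto)
  then obtain z where z: "z \<in> topspace X" "z \<noteq> q" "\<And>i. i < m \<Longrightarrow> h' i q \<le> merge_level X (h' i) q z" by blast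
  have le: "h' i q \<le> h' i z" if "i < m" for i
    using z(3)[OF that] tree_le2[OF T'[OF that] q(1) z(1)] by linarith
  have "(\<Sum>i<m. h' i z) \<le> (\<Sum>i<m. h' i q)" using qmax[OF z(1)] by (simp add: sum_h')
  have "h' i q = h' i z" if "i < m" for i
  proof (rule ccontr)
    assume "h' i q \<noteq> h' i z"
    then have "h' i q < h' i z" using le[OF that] by simp
    then have "(\<Sum>i<m. h' i q) < (\<Sum>i<m. h' i z)"
      using le that by (intro sum_strict_mono_ex1) auto
    with \<open>(\<Sum>i<m. h' i z) \<le> (\<Sum>i<m. h' i q)\<close> show False by simp
  qed
  then show False using inj'[OF q(1) z(1)] z(2) by blast
qed

lemma no_injection_into_product_of_curves:
  assumes X: "compact_space X" "connected_space X" "locally_connected_space X" "unicoherent_space X"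
    and Y: "\<And>i. i < m \<Longrightarrow> metrizable_space (Y i)" "\<And>i. i < m \<Longrightarrow> Y i dim_le 1"
    and \<phi>: "\<And>i. i < m \<Longrightarrow> continuous_map X (Y i) (\<phi> i)"
    and inj: "\<And>x y. x \<in> topspace X \<Longrightarrow> y \<in> topspace X \<Longrightarrow> (\<And>i. i < m \<Longrightarrow> \<phi> i x = \<phi> i y) \<Longrightarrow> x = y"
    and "m \<ge> 2"
    and P: "p1 \<in> topspace X" "p2 \<in> topspace X" "\<exists>q\<in>topspace X. q \<noteq> p1 \<and> q \<noteq> p2"
    and charts: "\<And>q. q \<in> topspace X \<Longrightarrow> q \<noteq> p1 \<Longrightarrow> q \<noteq> p2 \<Longrightarrow>
      \<exists>e. continuous_map (top_of_set (sym_cube m)) X e \<and> inj_on e (sym_cube m) \<and> e (\<lambda>_. 0) = q"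
  shows False
proof -
  have "\<exists>h. continuous_map X euclideanreal h \<and> (\<forall>x\<in>topspace X. 0 \<le> h x) \<and> h p1 = 0 \<and>
      (\<forall>x\<in>topspace X. \<forall>y\<in>topspace X. h x \<le> merge_level X h x y \<longrightarrow> h y \<le> merge_level X h x y \<longrightarrow> \<phi> i x = \<phi> i y)"
    if i: "i < m" for i
  proof -
    have sep: "\<exists>B c. openin X B \<and> connectedin X B \<and> connectedin X (topspace X - B) \<and> y \<in> B \<and> x \<notin> X closure_of B \<and>
        connectedin X (X frontier_of B) \<and> (\<forall>e\<in>X frontier_of B. \<phi> i e = c) \<and> c \<noteq> \<phi> i x \<and> c \<noteq> \<phi> i y"
      if "x \<in> topspace X" "y \<in> topspace X" "\<phi> i x \<noteq> \<phi> i y" for x y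
      by (rule curve_separation[OF X(2-4) \<phi>[OF i] metrizable_imp_Hausdorff_space[OF Y(1)[OF i]] Y(2)[OF i] that])
    obtain h where h: "continuous_map X euclideanreal h" "\<And>x. x \<in> topspace X \<Longrightarrow> 0 \<le> h x" "h p1 = 0"
      "\<And>x y. x \<in> topspace X \<Longrightarrow> y \<in> topspace X \<Longrightarrow> h x \<le> merge_level X h x y \<Longrightarrow> h y \<le> merge_level X h x y \<Longrightarrow> \<phi> i x = \<phi> i y"
      by (rule separating_height[OF X(1-3) \<phi>[OF i] Y(1)[OF i] P(1) sep]) (assumption | blast)+
    show ?thesis by (intro exI[of _ h] conjI ballI impI h)
  qed
  then have "\<forall>i. \<exists>h. i < m \<longrightarrow> continuous_map X euclideanreal h \<and> (\<forall>x\<in>topspace X. 0 \<le> h x) \<and> h p1 = 0 \<and>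
      (\<forall>x\<in>topspace X. \<forall>y\<in>topspace X. h x \<le> merge_level X h x y \<longrightarrow> h y \<le> merge_level X h x y \<longrightarrow> \<phi> i x = \<phi> i y)"
    by blast
  from choice[OF this] obtain h where H: "\<forall>i<m. continuous_map X euclideanreal (h i) \<and> (\<forall>x\<in>topspace X. 0 \<le> h i x) \<and> h i p1 = 0 \<and>
      (\<forall>x\<in>topspace X. \<forall>y\<in>topspace X. h i x \<le> merge_level X (h i) x y \<longrightarrow> h i y \<le> merge_level X (h i) x y \<longrightarrow> \<phi> i x = \<phi> i y)"
    by blast
  have h: "\<And>i. i < m \<Longrightarrow> continuous_map X euclideanreal (h i)"
    "\<And>i x. i < m \<Longrightarrow> x \<in> topspace X \<Longrightarrow> 0 \<le> h i x" "\<And>i. i < m \<Longrightarrow> h i p1 = 0"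
    and sep: "\<And>i x y. i < m \<Longrightarrow> x \<in> topspace X \<Longrightarrow> y \<in> topspace X \<Longrightarrow>
      h i x \<le> merge_level X (h i) x y \<Longrightarrow> h i y \<le> merge_level X (h i) x y \<Longrightarrow> \<phi> i x = \<phi> i y"
    using H by simp_all
  define \<mu> where "\<mu> i = merge_level X (h i)" for i
  have T: "tree_structure X (h i) (\<mu> i)" if "i < m" for i
    unfolding \<mu>_def by (rule tree_structure_merge_level[OF X(2) h(2)[OF that] X(3) h(1)[OF that]])
  have pos: "0 \<le> \<mu> i x y" if "i < m" "x \<in> topspace X" "y \<in> topspace X" for i x y
    unfolding \<mu>_def by (rule merge_level_bound[OF X(2) h(2)[OF that(1)] that(2,3)])
  have injT: "x = y" if "x \<in> topspace X" "y \<in> topspace X"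
    "\<And>i. i < m \<Longrightarrow> h i x \<le> \<mu> i x y \<and> h i y \<le> \<mu> i x y" for x y
    using inj[OF that(1,2)] sep[OF _ that(1,2)] that(3) unfolding \<mu>_def by blast
  have below: "h i x \<le> \<mu> i x p2" if x: "x \<in> topspace X" and i: "i < m" for x i
  proof (rule ccontr)
    assume neg: "\<not> h i x \<le> \<mu> i x p2"
    \<comment> \<open>S consists of the points above x in all trees, and q below has the greatest
      total height in S. It is not p2 by the assumption \<open>neg\<close>, and not p1, whose height
      is 0 while \<open>h i x\<close> is positive. So q has a chart, and the point z above it
      contradicts the choice of q.\<close>
    define S where "S = {y \<in> topspace X. \<forall>i<m. h i x \<le> \<mu> i x y}"
    have "closedin X {y \<in> topspace X. \<mu> j x y \<in> {h j x..}}" if "j < m" for j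
    proof -
      have "continuous_map X (prod_topology X X) (\<lambda>y. (x, y))" using x by (simp add: continuous_map_pairedI)
      from continuous_map_compose[OF this tree_continuous[OF T[OF that]]]
      have "continuous_map X euclideanreal (\<mu> j x)" by (simp add: o_def)
      then show ?thesis by (rule closedin_continuous_map_preimage) auto
    qed
    then have "closedin X (topspace X \<inter> (\<Inter>j\<in>{..<m}. {y \<in> topspace X. \<mu> j x y \<in> {h j x..}}))"
      using \<open>m \<ge> 2\<close> by (intro closedin_Int closedin_topspace closedin_INT) (auto simp: lessThan_empty_iff)
    also have "topspace X \<inter> (\<Inter>j\<in>{..<m}. {y \<in> topspace X. \<mu> j x y \<in> {h j x..}}) = S"
      by (auto simp: S_def)
    finally have S: "compactin X S" using X(1) by (rule closedin_compact_space[rotated])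
    have St: "S \<subseteq> topspace X" by (auto simp: S_def)
    have "\<mu> j x x = h j x" if "j < m" for j by (rule tree_refl[OF T[OF that] x])
    then have "x \<in> S" using x by (simp add: S_def)
    then have Sne: "S \<noteq> {}" by blast
    have "continuous_map X euclideanreal (\<lambda>y. \<Sum>j<m. h j y)" by (intro continuous_map_sum h(1)) auto
    then obtain q where q: "q \<in> S" "\<And>y. y \<in> S \<Longrightarrow> (\<Sum>j<m. h j y) \<le> (\<Sum>j<m. h j q)"
      using compact_space_attains_sup[OF S Sne] by blast
    have qt: "q \<in> topspace X" using q(1) St by blast
    have "q \<noteq> p2" using q(1) neg i by (auto simp: S_def)
    moreover have "q \<noteq> p1"
    proof
      assume "q = p1"
      then have "h i x \<le> \<mu> i x p1" using q(1) i by (simp add: S_def)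
      also have "\<dots> \<le> h i p1" by (rule tree_le2[OF T[OF i] x P(1)])
      finally show False using neg pos[OF i x P(2)] h(3)[OF i] by linarith
    qed
    ultimately obtain e where e: "continuous_map (top_of_set (sym_cube m)) X e" "inj_on e (sym_cube m)"
        "e (\<lambda>_. 0) = q"
      using charts[OF qt] by blast
    have "\<exists>z\<in>topspace X. z \<noteq> q \<and> (\<forall>i<m. h i q \<le> \<mu> i q z)"
      by (rule manifold_point_no_peak[OF T pos injT _ e]) (use \<open>m \<ge> 2\<close> in auto)
    then obtain z where z: "z \<in> topspace X" "z \<noteq> q" "\<And>i. i < m \<Longrightarrow> h i q \<le> \<mu> i q z" by blast
    have le: "h j q \<le> h j z" if "j < m" for j
      using z(3)[OF that] tree_le2[OF T[OF that] qt z(1)] by linarith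
    have "h j x \<le> \<mu> j x z" if "j < m" for j
    proof -
      have "h j x \<le> \<mu> j x q" using q(1) that by (simp add: S_def)
      moreover have "\<mu> j x q \<le> h j q" by (rule tree_le2[OF T[OF that] x qt])
      moreover have "min (\<mu> j x q) (\<mu> j q z) \<le> \<mu> j x z" by (rule tree_ultra[OF T[OF that] x qt z(1)])
      ultimately show ?thesis using z(3)[OF that] by linarith
    qed
    then have "z \<in> S" using z(1) by (simp add: S_def)
    have eq: "h j q = h j z" if "j < m" for j
    proof (rule ccontr)
      assume "h j q \<noteq> h j z"
      then have "h j q < h j z" using le[OF that] by simp
      then have "(\<Sum>j<m. h j q) < (\<Sum>j<m. h j z)"
        using le that by (intro sum_strict_mono_ex1) auto
      with q(2)[OF \<open>z \<in> S\<close>] show False by simp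
    qed
    have "q = z" by (rule injT[OF qt z(1)]) (use z(3) eq in auto)
    then show False using z(2) by blast
  qed
  \<comment> \<open>All points lie on the branch from the root to p2, so points of equal height in a
    tree coincide in it.\<close>
  have inj_h: "x = y" if xy: "x \<in> topspace X" "y \<in> topspace X" "\<And>i. i < m \<Longrightarrow> h i x = h i y" for x y
  proof (rule injT[OF xy(1,2)])
    fix i assume i: "i < m"
    have "min (\<mu> i x p2) (\<mu> i p2 y) \<le> \<mu> i x y" by (rule tree_ultra[OF T[OF i] xy(1) P(2) xy(2)])
    then show "h i x \<le> \<mu> i x y \<and> h i y \<le> \<mu> i x y"
      using below[OF xy(1) i] below[OF xy(2) i] xy(3)[OF i] tree_sym[OF T[OF i] P(2) xy(2)]
      by linarith
  qed
  show False
    by (rule no_injection_of_suspension_like[where h = h, OF X(1-3) h(1,2) inj_h \<open>m \<ge> 2\<close> P charts])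
qed

section \<open>Charts of the suspension and the passage from the manifold to the product\<close>

lemma locally_connected_interval: "locally_connected_space (top_of_set {-1..1::real})"
  unfolding locally_connected_space
proof (intro allI impI, elim conjE)
  fix V and x :: real assume V: "openin (top_of_set {-1..1}) V" and x: "x \<in> V"
  then obtain e where e: "e > 0" "ball x e \<inter> {-1..1} \<subseteq> V"
    unfolding openin_contains_ball by blast
  have "convex (ball x e \<inter> {-1..1})" by (intro convex_Int) auto
  then have "connected (ball x e \<inter> {-1..1})" by (rule convex_connected)
  moreover have "x \<in> {-1..1}" using openin_subset[OF V] x by auto
  ultimately show "\<exists>U. openin (top_of_set {-1..1}) U \<and> connectedin (top_of_set {-1..1}) U \<and> x \<in> U \<and> U \<subseteq> V"
    using e by (intro exI[of _ "ball x e \<inter> {-1..1}"])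
      (auto simp: connectedin_subtopology openin_open Int_commute)
qed

lemma locally_Euclidean_imp_locally_connected:
  assumes charts: "\<And>x. x \<in> topspace M \<Longrightarrow> \<exists>U. openin M U \<and> x \<in> U \<and>
      subtopology M U homeomorphic_space Euclidean_space n"
  shows "locally_connected_space M"
  unfolding locally_connected_space
proof (intro allI impI, elim conjE)
  fix V x assume V: "openin M V" and x: "x \<in> V"
  then have "x \<in> topspace M" using openin_subset by blast
  then obtain U where U: "openin M U" "x \<in> U" "subtopology M U homeomorphic_space Euclidean_space n"
    using charts by blast
  have "locally_connected_space (subtopology M U)"
    using homeomorphic_locally_connected_space[OF U(3)] locally_connected_Euclidean_space by blast
  moreover have "openin (subtopology M U) (V \<inter> U)" using V openin_subtopology by blast
  moreover have "x \<in> V \<inter> U" using x U(2) by blast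
  ultimately obtain C where C: "openin (subtopology M U) C" "connectedin (subtopology M U) C" "x \<in> C" "C \<subseteq> V \<inter> U"
    unfolding locally_connected_space by blast
  then have "openin M C" "connectedin M C"
    using U(1) by (simp_all add: openin_open_subtopology connectedin_subtopology)
  then show "\<exists>U. openin M U \<and> connectedin M U \<and> x \<in> U \<and> U \<subseteq> V" using C by blast
qed

lemma suspension_chart:
  fixes \<psi> :: "'a \<times> real \<Rightarrow> 'b"
  assumes \<psi>: "continuous_map (prod_topology K (top_of_set {-1..1})) X \<psi>"
    and fib: "\<And>p q. p \<in> topspace K \<times> {-1..1} \<Longrightarrow> q \<in> topspace K \<times> {-1..1} \<Longrightarrow>
      \<psi> p = \<psi> q \<longleftrightarrow> p = q \<or> snd p = 1 \<and> snd q = 1 \<or> snd p = -1 \<and> snd q = -1"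
    and U: "openin K U" "subtopology K U homeomorphic_space Euclidean_space n"
    and x: "x \<in> U" and t: "-1 < t" "t < 1"
  obtains e where "continuous_map (top_of_set (sym_cube (Suc n))) X e" "inj_on e (sym_cube (Suc n))"
    "e (\<lambda>_. 0) = \<psi> (x, t)"
proof -
  obtain g g' where "homeomorphic_maps (subtopology K U) (Euclidean_space n) g g'"
    using U(2) unfolding homeomorphic_space_def by blast
  then have g: "continuous_map (subtopology K U) (Euclidean_space n) g"
    "continuous_map (Euclidean_space n) (subtopology K U) g'"
    "\<And>y. y \<in> topspace (subtopology K U) \<Longrightarrow> g' (g y) = y"
    "\<And>v. v \<in> topspace (Euclidean_space n) \<Longrightarrow> g (g' v) = v"
    unfolding homeomorphic_maps_def by auto
  have xU: "x \<in> topspace (subtopology K U)" using x U(1) openin_subset by fastforce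
  then have gx: "g x \<in> topspace (Euclidean_space n)" using g(1) by (auto simp: continuous_map_def)
  define v where "v b = (\<lambda>i. if i < n then g x i + b i else (0::real))" for b
  \<comment> \<open>The half-length \<open>(1 - \<bar>t\<bar>) / 2\<close> keeps the cell strictly
    between the poles, where \<open>\<psi>\<close> is injective.\<close>
  define \<tau> where "\<tau> b = t + (1 - \<bar>t\<bar>) / 2 * b n" for b :: "nat \<Rightarrow> real"
  define e where "e b = \<psi> (g' (v b), \<tau> b)" for b
  let ?C = "sym_cube (Suc n)"
  have vE: "v b \<in> topspace (Euclidean_space n)" for b by (simp add: v_def topspace_Euclidean_space)
  have g'K: "g' (v b) \<in> topspace K" for b
    using g(2) vE[of b] by (auto simp: continuous_map_def)
  have \<tau>: "-1 < \<tau> b" "\<tau> b < 1" if "b \<in> ?C" for b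
  proof -
    have r: "0 < (1 - \<bar>t\<bar>) / 2" using t by auto
    have "\<bar>b n\<bar> \<le> 1" using that by (simp add: sym_cube_def)
    then have "\<bar>(1 - \<bar>t\<bar>) / 2 * b n\<bar> \<le> (1 - \<bar>t\<bar>) / 2"
      using r by (simp add: abs_mult mult_left_le)
    moreover define w where "w = (1 - \<bar>t\<bar>) / 2 * b n"
    ultimately have "\<bar>w\<bar> \<le> (1 - \<bar>t\<bar>) / 2" "\<tau> b = t + w" by (simp_all add: \<tau>_def)
    then show "-1 < \<tau> b" "\<tau> b < 1" using t
      by (cases "0 \<le> t"; simp add: abs_le_iff)+
  qed
  have coord: "continuous_map (top_of_set ?C) euclideanreal (\<lambda>b. b i)" for i
    by (simp add: continuous_on_subset[OF continuous_on_product_coordinates])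
  have "continuous_map (top_of_set ?C) (Euclidean_space n) v"
    unfolding v_def continuous_map_componentwise_Euclidean_space
    by (intro allI impI continuous_map_add coord) auto
  from continuous_map_compose[OF this continuous_map_into_fulltopology[OF g(2)]]
  have "continuous_map (top_of_set ?C) K (\<lambda>b. g' (v b))" by (simp add: o_def)
  moreover have "continuous_map (top_of_set ?C) (top_of_set {-1..1}) \<tau>"
  proof -
    have "continuous_map (top_of_set ?C) euclideanreal \<tau>"
      unfolding \<tau>_def by (intro continuous_map_add continuous_map_real_mult coord) auto
    then show ?thesis using \<tau> by (force simp: continuous_map_in_subtopology)
  qed
  ultimately have "continuous_map (top_of_set ?C) (prod_topology K (top_of_set {-1..1})) (\<lambda>b. (g' (v b), \<tau> b))"
    by (rule continuous_map_pairedI)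
  from continuous_map_compose[OF this \<psi>] have "continuous_map (top_of_set ?C) X e"
    by (simp add: o_def e_def[abs_def])
  moreover have "inj_on e ?C"
  proof (rule inj_onI)
    fix b c assume bc: "b \<in> ?C" "c \<in> ?C" "e b = e c"
    have "(g' (v b), \<tau> b) \<in> topspace K \<times> {-1..1}" "(g' (v c), \<tau> c) \<in> topspace K \<times> {-1..1}"
      using g'K \<tau>[OF bc(1)] \<tau>[OF bc(2)] by auto
    from fib[OF this] have "(g' (v b), \<tau> b) = (g' (v c), \<tau> c)"
      using bc(3) \<tau>(2)[OF bc(1)] \<tau>(1)[OF bc(1)] unfolding e_def snd_conv by argo
    then have "g' (v b) = g' (v c)" "\<tau> b = \<tau> c" by simp_all
    from arg_cong[OF this(1), of g] have "v b = v c" by (simp only: g(4)[OF vE])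
    have "b i = c i" for i
    proof -
      consider "i < n" | "i = n" | "i > n" by linarith
      then show ?thesis
      proof cases
        case 1
        then show ?thesis using fun_cong[OF \<open>v b = v c\<close>, of i] by (simp add: v_def)
      next
        case 2
        then show ?thesis using \<open>\<tau> b = \<tau> c\<close> t by (auto simp: \<tau>_def)
      next
        case 3
        then show ?thesis using bc(1,2) by (simp add: sym_cube_def)
      qed
    qed
    then show "b = c" by (rule ext)
  qed
  moreover have "v (\<lambda>_. 0) = g x"
    using gx by (auto simp: v_def fun_eq_iff topspace_Euclidean_space)
  then have "e (\<lambda>_. 0) = \<psi> (x, t)" using g(3)[OF xU] by (simp add: e_def \<tau>_def)
  ultimately show thesis by (rule that)
qed

theorem theorem1p2:
  fixes n :: nat and M :: "'a topology"
  assumes "n \<ge> 1"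
    and "closed_manifold n M"
  shows "\<not> (\<exists>(Y :: nat \<Rightarrow> 'b topology) f.
            (\<forall>i\<in>{1..n + 1}. curve (Y i)) \<and>
            embedding_map (suspension M) (product_topology Y {1..n + 1}) f)"
proof (rule notI, elim exE conjE)
  fix Y :: "nat \<Rightarrow> 'b topology" and f
  assume curves: "\<forall>i\<in>{1..n + 1}. curve (Y i)"
    and emb: "embedding_map (suspension M) (product_topology Y {1..n + 1}) f"
  let ?P = "product_topology Y {1..n + 1}" and ?I = "top_of_set {-1..1::real}"
  have M: "compact_space M" "has_dimension M n"
    and charts: "\<And>x. x \<in> topspace M \<Longrightarrow> \<exists>U. openin M U \<and> x \<in> U \<and>
      subtopology M U homeomorphic_space Euclidean_space n"
    using assms(2) by (auto simp: closed_manifold_def compactum_def)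
  have Ym: "metrizable_space (Y i)" "Y i dim_le 1" if "i \<in> {1..n + 1}" for i
    using curves that by (auto simp: curve_def continuum_def compactum_def has_dimension_def)
  have lcM: "locally_connected_space M" by (rule locally_Euclidean_imp_locally_connected[OF charts])
  \<comment> \<open>The empty space has dimension -1, hence at most n - 1, which dimension exactly n
    forbids.\<close>
  have "topspace M \<noteq> {}"
  proof
    assume "topspace M = {}"
    then have "M dim_le (-1)" by simp
    then have "M dim_le (int n - 1)" by (rule dimension_le_mono) simp
    then show False using M(2) by (simp add: has_dimension_def)
  qed
  then obtain x0 where x0: "x0 \<in> topspace M" by blast
  \<comment> \<open>M may be disconnected, while unicoherence is proved for the suspension of a
    connected space. Local connectedness makes the component open, so it inherits the
    charts.\<close>
  define C where "C = connected_component_of_set M x0"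
  have C: "openin M C" "closedin M C" "connectedin M C" "x0 \<in> C"
    unfolding C_def using openin_connected_component_of_locally_connected_space[OF lcM] x0
    by (simp_all add: closedin_connected_component_of connectedin_connected_component_of connected_component_of_refl)
  have Ct: "C \<subseteq> topspace M" using C(1) by (rule openin_subset)
  define K where "K = subtopology M C"
  have Kt: "topspace K = C" using Ct by (auto simp: K_def)
  have K: "compact_space K" "connected_space K" "locally_connected_space K"
    unfolding K_def using M(1) C lcM
    by (simp_all add: compact_space_subtopology closedin_compact_space locally_connected_space_open_subset
        connectedin_def)
  let ?Z = "prod_topology K ?I"
  define \<psi> where "\<psi> p = f (suspension_rel M `` {p})" for p
  have Zcyl: "?Z = subtopology (cylinder M) (C \<times> {-1..1})"
    by (simp add: K_def cylinder_def prod_topology_subtopology(1))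
  have cyl: "topspace (cylinder M) = topspace M \<times> {-1..1}" by (simp add: cylinder_def)
  have "continuous_map (cylinder M) (suspension M) (\<lambda>p. suspension_rel M `` {p})"
    unfolding suspension_def by (rule quotient_imp_continuous_map[OF quotient_map_quotient_topology])
  moreover have "continuous_map (suspension M) ?P f"
    using emb unfolding embedding_map_def
    by (meson continuous_map_into_fulltopology homeomorphic_imp_continuous_map)
  ultimately have "continuous_map (cylinder M) ?P \<psi>"
    using continuous_map_compose[of "cylinder M" "suspension M"] by (fastforce simp: o_def \<psi>_def[abs_def])
  then have \<psi>P: "continuous_map ?Z ?P \<psi>" unfolding Zcyl by (rule continuous_map_from_subtopology)
  have inj_f: "inj_on f (topspace (suspension M))"
    using emb by (simp add: embedding_map_def homeomorphic_imp_injective_map)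
  have fib: "\<psi> p = \<psi> q \<longleftrightarrow> p = q \<or> snd p = 1 \<and> snd q = 1 \<or> snd p = -1 \<and> snd q = -1"
    if "p \<in> topspace K \<times> {-1..1}" "q \<in> topspace K \<times> {-1..1}" for p q
  proof -
    have pq: "p \<in> topspace (cylinder M)" "q \<in> topspace (cylinder M)" using that Kt Ct cyl by auto
    have "\<psi> p = \<psi> q \<longleftrightarrow> suspension_rel M `` {p} = suspension_rel M `` {q}"
      unfolding \<psi>_def using inj_f pq
      by (simp add: inj_on_eq_iff topspace_suspension quotientI)
    also have "\<dots> \<longleftrightarrow> (p, q) \<in> suspension_rel M"
      by (rule eq_equiv_class_iff[OF equiv_suspension_rel pq])
    finally show ?thesis using pq by (simp add: suspension_rel_def)
  qed
  \<comment> \<open>As a subspace of the product, the image is Hausdorff at once, and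
    \<open>\<psi>\<close>, defined on a compact space, is then a quotient map onto it.\<close>
  define X where "X = subtopology ?P (\<psi> ` topspace ?Z)"
  have "\<psi> ` topspace ?Z \<subseteq> topspace ?P" by (rule continuous_map_image_subset_topspace[OF \<psi>P])
  then have Xt: "topspace X = \<psi> ` topspace ?Z" by (auto simp: X_def)
  have \<psi>X: "continuous_map ?Z X \<psi>" unfolding X_def using \<psi>P by (simp add: continuous_map_in_subtopology)
  have haus: "Hausdorff_space X"
    unfolding X_def using metrizable_imp_Hausdorff_space[OF Ym(1)]
    by (intro Hausdorff_space_subtopology) (simp add: Hausdorff_space_product_topology)
  have Z: "compact_space ?Z" "connected_space ?Z" "locally_connected_space ?Z"
    using K locally_connected_interval
    by (auto simp: compact_space_prod_topology connected_space_prod_topology locally_connected_space_prod_topology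
        compact_space_subtopology connected_space_subtopology)
  have quot: "quotient_map ?Z X \<psi>"
    by (intro continuous_closed_imp_quotient_map \<psi>X continuous_imp_closed_map_gen Z(1) haus
        Hausdorff_imp_kc_space Xt[symmetric])
  have X: "compact_space X" "connected_space X" "locally_connected_space X"
  proof -
    show "compact_space X"
      using image_compactin[OF _ \<psi>X, of "topspace ?Z"] Z(1) by (simp add: compact_space_def Xt)
    show "connected_space X"
      using connectedin_continuous_map_image[OF \<psi>X, of "topspace ?Z"] Z(2) by (simp add: Xt flip: connectedin_topspace)
    show "locally_connected_space X"
      by (rule locally_connected_space_quotient_map_image[OF Z(3) quot])
  qed
  have uni: "unicoherent_space X"
    by (rule unicoherent_suspension[OF K(1,2) quot fib])
      (use X(1) haus compact_Hausdorff_or_regular_imp_normal_space in auto)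
  show False
  \<comment> \<open>The shift by \<open>Suc\<close> matches the indices 0 to n of the lemma with the
    factors 1 to n + 1.\<close>
  proof (rule no_injection_into_product_of_curves[OF X uni, where m = "Suc n" and Y = "\<lambda>i. Y (Suc i)"
        and \<phi> = "\<lambda>i x. x (Suc i)" and ?p1.0 = "\<psi> (x0, 1)" and ?p2.0 = "\<psi> (x0, -1)"])
    show "metrizable_space (Y (Suc i))" "Y (Suc i) dim_le 1" if "i < Suc n" for i
      using Ym[of "Suc i"] that by auto
    show "continuous_map X (Y (Suc i)) (\<lambda>x. x (Suc i))" if "i < Suc n" for i
      unfolding X_def by (intro continuous_map_from_subtopology continuous_map_product_projection) (use that in auto)
    show "x = y" if "x \<in> topspace X" "y \<in> topspace X" "\<And>i. i < Suc n \<Longrightarrow> x (Suc i) = y (Suc i)" for x y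
    proof -
      have "x \<in> PiE {1..n + 1} (\<lambda>i. topspace (Y i))" "y \<in> PiE {1..n + 1} (\<lambda>i. topspace (Y i))"
        using that(1,2) by (auto simp: X_def)
      moreover have "x i = y i" if "i \<in> {1..n + 1}" for i
        using \<open>\<And>i. i < Suc n \<Longrightarrow> x (Suc i) = y (Suc i)\<close>[of "i - 1"] that by auto
      ultimately show ?thesis by (rule PiE_ext)
    qed
    show "\<psi> (x0, 1) \<in> topspace X" "\<psi> (x0, -1) \<in> topspace X" using C(4) by (auto simp: Xt Kt)
    show "\<exists>q\<in>topspace X. q \<noteq> \<psi> (x0, 1) \<and> q \<noteq> \<psi> (x0, -1)"
      using C(4) fib[of "(x0, 0)" "(x0, 1)"] fib[of "(x0, 0)" "(x0, -1)"]
      by (intro bexI[of _ "\<psi> (x0, 0)"]) (auto simp: Xt Kt)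
    show "\<exists>e. continuous_map (top_of_set (sym_cube (Suc n))) X e \<and> inj_on e (sym_cube (Suc n)) \<and> e (\<lambda>_. 0) = q"
      if q: "q \<in> topspace X" "q \<noteq> \<psi> (x0, 1)" "q \<noteq> \<psi> (x0, -1)" for q
    proof -
      obtain x t where xt: "q = \<psi> (x, t)" "x \<in> C" "-1 \<le> t" "t \<le> 1" using q(1) by (auto simp: Xt Kt)
      have "t \<noteq> 1" "t \<noteq> -1"
        using q(2,3) fib[of "(x, t)" "(x0, 1)"] fib[of "(x, t)" "(x0, -1)"] xt C(4) Kt by auto
      then have t: "-1 < t" "t < 1" using xt by auto
      obtain U where U: "openin M U" "x \<in> U" "subtopology M U homeomorphic_space Euclidean_space n"
        using charts[of x] xt(2) Ct by blast
      \<comment> \<open>A Euclidean neighbourhood is connected, so it stays inside the component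
        C.\<close>
      have "connected_space (subtopology M U)"
        using homeomorphic_connected_space[OF U(3)] connected_Euclidean_space by blast
      then have "connectedin M U" using openin_subset[OF U(1)] by (simp add: connectedin_def)
      then have "U \<subseteq> connected_component_of_set M x" using U(2) by (rule connected_component_of_maximal)
      also have "connected_component_of_set M x = C"
        using xt(2) connected_component_of_equiv[of M x0 x] by (simp add: C_def)
      finally have UC: "U \<subseteq> C" .
      have "openin K U" unfolding K_def using U(1) UC C(1) by (simp add: openin_open_subtopology)
      moreover have "subtopology K U homeomorphic_space Euclidean_space n"
        using U(3) UC by (simp add: K_def subtopology_subtopology Int_absorb1)
      ultimately obtain e where "continuous_map (top_of_set (sym_cube (Suc n))) X e"
        "inj_on e (sym_cube (Suc n))" "e (\<lambda>_. 0) = \<psi> (x, t)"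
        using suspension_chart[OF \<psi>X fib _ _ U(2) t] by blast
      then show ?thesis using xt(1) by blast
    qed
    show "Suc n \<ge> 2" using assms(1) by simp
  qed
qed

end
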